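(* Let $b$ be a positive integer, $p$ an odd prime and $G$ a finite abelian group. Write $|G|=p^cm$ with $c\geq 0$ and $p\nmid m$, and suppose $m$ is not a perfect square. Let $q_1,\dots,q_s$ be the distinct prime divisors of $m$ and put $f=\gcd(\operatorname{ord}_p(q_1),\dots,\operatorname{ord}_p(q_s))$. If either a $\mathrm{BH}(G,p^b)$ matrix or a $\mathrm{BH}(G,2p^b)$ matrix exists, then: (i) $f$ is odd; (ii) either $f\leq m$ or $p\leq (f^2-m)/(f-m)$; (iii) $p\leq m^2+m+1$.
   Context: For a finite abelian group $(G,+)$ and a positive integer $h$, a $\mathrm{BH}(G,h)$ matrix is a $|G|\times|G|$ matrix $H=(a_{g,k})_{g,k\in G}$ whose entries are complex $h$th roots of unity, which is $G$-invariant (i.e. $a_{g+l,k+l}=a_{g,k}$ for all $g,k,l\in G$), and satisfies $HH^*=|G|I$. For a prime $q\neq p$, $\operatorname{ord}_p(q)$ is the least positive $j$ with $q^j\equiv1\pmod p$. *)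

theory Defs
  imports
    Complex_Main
    "HOL-Algebra.Coset"
    "HOL-Computational_Algebra.Nth_Powers"
    "HOL-Number_Theory.Number_Theory"
begin

(* A matrix with rows and columns indexed by G is a function on pairs of elements; only its
   values on the carrier matter. The group is written multiplicatively. *)
definition is_BH :: "('a, 'b) monoid_scheme \<Rightarrow> nat \<Rightarrow> ('a \<Rightarrow> 'a \<Rightarrow> complex) \<Rightarrow> bool" where
  "is_BH G h H \<longleftrightarrow>
     (\<forall>g\<in>carrier G. \<forall>k\<in>carrier G. H g k ^ h = 1) \<and>
     (\<forall>g\<in>carrier G. \<forall>k\<in>carrier G. \<forall>l\<in>carrier G.
        H (g \<otimes>\<^bsub>G\<^esub> l) (k \<otimes>\<^bsub>G\<^esub> l) = H g k) \<and>
     (\<forall>g\<in>carrier G. \<forall>k\<in>carrier G.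
        (\<Sum>l\<in>carrier G. H g l * cnj (H k l)) = (if g = k then of_nat (order G) else 0))"

end

theory Submission
  imports Defs "HOL-Computational_Algebra.Polynomial_Factorial"
begin

text \<open>
  Put \<open>n = p^b\<close>, and let \<open>\<zeta>\<close> be a primitive \<open>n\<close>-th root of unity. The row sum \<open>X\<close> of the matrix lies in
  \<open>\<int>[\<zeta>]\<close> and has \<open>|X|\<^sup>2 = p^c m\<close>. The only prime above \<open>p\<close> is \<open>1 - \<zeta>\<close>, and the product of \<open>1 - \<zeta>^k\<close> over
  half of the units has squared modulus \<open>p\<close>, so \<open>c\<close> divisions by it leave \<open>Y \<in> \<int>[\<zeta>]\<close> with \<open>|Y|\<^sup>2 = m\<close>.

  Write \<open>Y = \<Sum>i<n. c i * \<zeta>^i\<close>. Summing the squared moduli of all conjugates of \<open>Y\<close> gives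
  \<open>\<Sum>\<^sub>C (p * \<Sum>\<^sub>C c\<^sup>2 - (\<Sum>\<^sub>C c)\<^sup>2) = (p - 1) m\<close>, where \<open>C\<close> ranges over the cosets of the subgroup of order
  \<open>p\<close> of \<open>\<int>/n\<close>. For \<open>m = 1\<close> this identity says that an element all of whose conjugates have modulus 1 is
  \<open>\<plusminus>\<zeta>^i\<close>. For general \<open>m\<close>, adding constants on the cosets to make the coset sums small, it
  gives (iii) by the counting argument for planar difference sets.

  For the rest, \<open>q\<close> is unramified: if \<open>q^a\<close> divides \<open>Y * Z\<close> then \<open>q^a\<close> divides \<open>\<sigma>(Y) * Z\<close> for
  the Frobenius \<open>\<sigma>\<close> of \<open>q\<close>. If \<open>f\<close> is even, complex conjugation is a power of every such \<open>\<sigma>\<close>, so every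
  prime has even multiplicity in \<open>m\<close>, which proves (i). In general the Frobenius maps share an
  automorphism \<open>\<zeta> \<mapsto> \<zeta>^t\<close> of order \<open>f\<close>; it multiplies \<open>Y\<close> by a root of unity, and \<open>Y\<close> can be normalised to
  be fixed. Then \<open>c\<close> is essentially constant on orbits of \<open>t\<close>, which have length \<open>f\<close>, and the
  identity yields \<open>f \<le> m\<close> or \<open>f (p - f) \<le> (p - 1) m\<close>, which is (ii).
\<close>

hide_const (open) Polynomial.order

section \<open>Integer polynomials at complex numbers\<close>

text \<open>Elements of Z[\<zeta>] are handled as values at \<zeta> of integer polynomials. The
  conjugate under \<zeta> \<mapsto> \<zeta>^k is then the value of the same polynomial at
  \<zeta>^k.\<close>

definition ev :: "complex \<Rightarrow> int poly \<Rightarrow> complex" where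
  "ev z P = poly (map_poly of_int P) z"

lemma ev_0 [simp]: "ev z 0 = 0"
  by (simp add: ev_def)

lemma ev_pCons [simp]: "ev z (pCons a P) = of_int a + z * ev z P"
  by (simp add: ev_def map_poly_pCons)

lemma ev_1 [simp]: "ev z 1 = 1"
  by (simp add: one_pCons)

lemma ev_add [simp]: "ev z (P + Q) = ev z P + ev z Q"
  by (induction P Q rule: poly_induct2) (simp_all add: algebra_simps)

lemma ev_smult [simp]: "ev z (smult a P) = of_int a * ev z P"
  by (induction P) (simp_all add: algebra_simps)

lemma ev_minus [simp]: "ev z (- P) = - ev z P"
  using ev_smult[of z "-1" P] by simp

lemma ev_diff [simp]: "ev z (P - Q) = ev z P - ev z Q"
  using ev_add[of z P "- Q"] by simp

lemma ev_mult [simp]: "ev z (P * Q) = ev z P * ev z Q"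
  by (induction P) (simp_all add: algebra_simps)

lemma ev_power [simp]: "ev z (P ^ k) = ev z P ^ k"
  by (induction k) simp_all

lemma ev_sum [simp]: "ev z (\<Sum>i\<in>A. P i) = (\<Sum>i\<in>A. ev z (P i))"
  by (induction A rule: infinite_finite_induct) simp_all

lemma ev_prod [simp]: "ev z (\<Prod>i\<in>A. P i) = (\<Prod>i\<in>A. ev z (P i))"
  by (induction A rule: infinite_finite_induct) simp_all

lemma ev_of_nat [simp]: "ev z (of_nat k) = of_nat k"
  by (induction k) simp_all

lemma ev_monom [simp]: "ev z (monom a k) = of_int a * z ^ k"
  by (induction k) (simp_all add: monom_0 monom_Suc algebra_simps)

lemma ev_pcompose_monom [simp]: "ev z (pcompose P (monom 1 k)) = ev (z ^ k) P"
  by (induction P) (simp_all add: pcompose_pCons)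

lemma ev_at_1: "ev 1 P = of_int (poly P 1)"
  by (induction P) simp_all

lemma cnj_ev: "cnj (ev z P) = ev (cnj z) P"
  by (induction P) simp_all

lemma prod_ev_dvd:
  assumes "finite A" "\<And>k. k \<in> A \<Longrightarrow> \<exists>P. f k = g k * ev z P"
  shows "\<exists>P. (\<Prod>k\<in>A. f k) = (\<Prod>k\<in>A. g k) * ev z P"
proof -
  obtain P where P: "\<And>k. k \<in> A \<Longrightarrow> f k = g k * ev z (P k)" using assms(2) by metis
  then have "(\<Prod>k\<in>A. f k) = (\<Prod>k\<in>A. g k) * ev z (\<Prod>k\<in>A. P k)"
    by (simp add: prod.distrib)
  then show ?thesis by blast
qed

section \<open>Frobenius congruences and Eisenstein's criterion\<close>

text \<open>The inner binomial coefficients are multiples of \<open>q\<close>. A general commutative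
  ring is used because both integers and integer polynomials occur below.\<close>

lemma prime_dvd_binomial_defect:
  fixes a b :: "'a :: comm_ring_1"
  assumes "prime q"
  shows "of_nat q dvd (a + b) ^ q - a ^ q - b ^ q"
proof -
  have q: "q > 1" using assms prime_gt_1_nat by blast
  define g where "g k = of_nat (q choose k) * a ^ k * b ^ (q - k)" for k
  have "(a + b) ^ q = (\<Sum>k\<le>q. g k)"
    by (simp add: binomial_ring g_def)
  also have "{..q} = insert 0 (insert q {1..<q})" using q by auto
  also have "(\<Sum>k\<in>\<dots>. g k) = b ^ q + a ^ q + (\<Sum>k=1..<q. g k)"
    using q by (simp add: g_def)
  finally have "(a + b) ^ q - a ^ q - b ^ q = (\<Sum>k=1..<q. g k)" by simp
  moreover have "of_nat q dvd g k" if "k \<in> {1..<q}" for k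
  proof -
    have "q dvd (q choose k)" using that assms by (intro dvd_choose_prime) auto
    then have "(of_nat q :: 'a) dvd of_nat (q choose k)"
      by (metis dvdE dvd_triv_left of_nat_mult)
    then show ?thesis by (simp add: g_def)
  qed
  ultimately show ?thesis by (simp only: dvd_sum)
qed

lemma prime_dvd_power_minus_self:
  fixes a :: int
  assumes "prime q"
  shows "of_nat q dvd a ^ q - a"
proof (induction a rule: int_induct[where k = 0])
  case base
  show ?case using prime_gt_0_nat[OF assms] by (simp add: zero_power)
next
  case (step1 i)
  have "(i + 1) ^ q - (i + 1) = ((i + 1) ^ q - i ^ q - 1 ^ q) + (i ^ q - i)" by simp
  then show ?case using step1 prime_dvd_binomial_defect[OF assms, of i 1] by (simp only: dvd_add)
next
  case (step2 i)
  have "(i - 1) ^ q - (i - 1) = (i ^ q - i) - ((i - 1 + 1) ^ q - (i - 1) ^ q - 1 ^ q)" by simp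
  then show ?case using step2 prime_dvd_binomial_defect[OF assms, of "i - 1" 1] by (simp only: dvd_diff)
qed

text \<open>Evaluated at \<zeta>, this says that \<zeta> \<mapsto> \<zeta>^q acts as the
  \<open>q\<close>-th power map modulo \<open>q\<close>. Each coefficient is split off by the
  binomial congruence and is itself covered by Fermat's little theorem.\<close>

lemma frobenius_poly:
  fixes P :: "int poly"
  assumes "prime q"
  shows "of_nat q dvd P ^ q - pcompose P (monom 1 q)"
proof (induction P)
  case 0
  show ?case using prime_gt_0_nat[OF assms] by (simp add: zero_power)
next
  case (pCons a P)
  define x where "x = monom (1::int) 1"
  have e: "pCons a P = [:a:] + x * P"
    by (simp add: x_def monom_Suc monom_0)
  have c: "pcompose (pCons a P) (monom 1 q) = [:a:] + x ^ q * pcompose P (monom 1 q)"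
    by (simp add: pcompose_pCons x_def monom_power)
  have "[:a:] ^ q - [:a:] = [:a ^ q - a:]" by (simp add: poly_const_pow)
  moreover have "of_nat q dvd [:a ^ q - a:]"
    using prime_dvd_power_minus_self[OF assms, of a] by (auto simp: of_nat_poly const_poly_dvd_const_poly_iff elim!: dvdE)
  ultimately have "of_nat q dvd [:a:] ^ q - [:a:]" by simp
  moreover have "of_nat q dvd x ^ q * (P ^ q - pcompose P (monom 1 q))"
    using pCons by (intro dvd_mult) auto
  moreover note prime_dvd_binomial_defect[OF assms, of "[:a:]" "x * P"]
  ultimately have "of_nat q dvd (([:a:] + x * P) ^ q - [:a:] ^ q - (x * P) ^ q)
     + ([:a:] ^ q - [:a:]) + x ^ q * (P ^ q - pcompose P (monom 1 q))"
    by (intro dvd_add) auto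
  also have "\<dots> = (pCons a P) ^ q - pcompose (pCons a P) (monom 1 q)"
    unfolding c unfolding e by (simp add: algebra_simps)
  finally show ?case .
qed

lemma dvd_power_diff: "d dvd a - b \<Longrightarrow> d dvd a ^ k - b ^ k" for a b d :: "'a :: comm_ring_1"
  by (metis dvd_mult2 power_diff_sumr2)

lemma pcompose_power: "pcompose (P ^ k) Q = pcompose P Q ^ k" for P Q :: "'a :: comm_ring_1 poly"
  by (induction k) (simp_all add: pcompose_mult pcompose_1)

lemma pcompose_monom: "pcompose (monom (1 :: 'a :: comm_ring_1) k) Q = Q ^ k"
  by (induction k) (simp_all add: monom_0 monom_Suc pcompose_pCons pcompose_const)

lemma frobenius_poly_iterated:
  fixes P :: "int poly"
  assumes "prime q"
  shows "of_nat q dvd P ^ (q ^ k) - pcompose P (monom 1 (q ^ k))"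
proof (induction k arbitrary: P)
  case 0
  have "monom (1::int) 1 = [:0, 1:]" by (simp add: monom_Suc monom_0)
  then show ?case by (simp add: pcompose_idR)
next
  case (Suc k)
  have "of_nat q dvd (P ^ q) ^ (q ^ k) - pcompose P (monom 1 q) ^ (q ^ k)"
    by (intro dvd_power_diff frobenius_poly assms)
  moreover have "of_nat q dvd pcompose P (monom 1 q) ^ (q ^ k) - pcompose (pcompose P (monom 1 q)) (monom 1 (q ^ k))"
    by (rule Suc.IH)
  moreover have "pcompose (pcompose P (monom 1 q)) (monom 1 (q ^ k)) = pcompose P (monom 1 (q ^ Suc k))"
  proof -
    have "pcompose (monom (1::int) q) (monom 1 (q ^ k)) = monom 1 (q ^ Suc k)"
    proof -
      have "monom (1::int) q = monom 1 1 ^ q" by (simp add: monom_power)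
      moreover have "pcompose (monom (1::int) 1) (monom 1 (q ^ k)) = monom 1 (q ^ k)"
        by (simp add: monom_Suc monom_0 pcompose_pCons)
      ultimately show ?thesis by (simp only: pcompose_power) (simp add: monom_power mult.commute)
    qed
    then show ?thesis by (simp add: pcompose_assoc[symmetric])
  qed
  ultimately have "of_nat q dvd ((P ^ q) ^ (q ^ k) - pcompose P (monom 1 q) ^ (q ^ k))
     + (pcompose P (monom 1 q) ^ (q ^ k) - pcompose P (monom 1 (q ^ Suc k)))"
    by (intro dvd_add) simp_all
  then show ?case by (simp add: power_mult)
qed

text \<open>Each \<open>q\<close>-th power gains a factor \<open>q\<close>: \<open>x^q - y^q\<close>
  is \<open>x - y\<close> times a sum of \<open>q\<close> terms, all congruent to
  \<open>y^(q - 1)\<close> modulo \<open>q\<close>.\<close>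

lemma power_prime_power_cong:
  fixes a b :: "'a :: comm_ring_1"
  assumes "of_nat q dvd a - b"
  shows "of_nat (q ^ Suc k) dvd a ^ (q ^ k) - b ^ (q ^ k)"
proof (induction k)
  case 0
  show ?case using assms by simp
next
  case (Suc k)
  define x y where "x = a ^ (q ^ k)" and "y = b ^ (q ^ k)"
  have xy: "of_nat q dvd x - y" using assms dvd_power_diff x_def y_def by blast
  have "(\<Sum>i<q. y ^ (q - Suc i) * x ^ i) = (\<Sum>i<q. y ^ (q - Suc i) * (x ^ i - y ^ i)) + (\<Sum>i<q. y ^ (q - 1))"
    unfolding sum.distrib[symmetric]
    by (intro sum.cong) (auto simp: right_diff_distrib simp flip: power_add)
  moreover have "of_nat q dvd (\<Sum>i<q. y ^ (q - Suc i) * (x ^ i - y ^ i))"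
    using xy by (intro dvd_sum dvd_mult dvd_power_diff)
  ultimately have "of_nat q dvd (\<Sum>i<q. y ^ (q - Suc i) * x ^ i)" by simp
  with Suc have "of_nat (q ^ Suc k) * of_nat q dvd (x - y) * (\<Sum>i<q. y ^ (q - Suc i) * x ^ i)"
    unfolding x_def y_def by (intro mult_dvd_mono)
  then show ?case
    unfolding power_diff_sumr2[symmetric] x_def y_def
    by (simp flip: power_mult add: mult_ac)
qed

text \<open>If \<open>i\<close> is the first index where \<open>f\<close> has a coefficient prime to
  \<open>p\<close>, then coefficient \<open>i\<close> of \<open>f * h\<close> is prime to
  \<open>p\<close> as well. So \<open>i\<close> is at least the degree of the product, but at most
  the degree of \<open>f\<close>.\<close>

lemma eisenstein_aux:
  fixes f h :: "int poly" and p :: int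
  assumes p: "prime p" and h0: "\<not> p dvd coeff h 0"
    and F: "\<And>i. i < degree (f * h) \<Longrightarrow> p dvd coeff (f * h) i"
    and lc: "\<not> p dvd lead_coeff (f * h)"
  shows "degree h = 0"
proof -
  have nz: "f \<noteq> 0" "h \<noteq> 0" using lc by auto
  have "\<not> p dvd lead_coeff f" using lc by (auto simp: lead_coeff_mult)
  define i where "i = (LEAST i. \<not> p dvd coeff f i)"
  have i: "\<not> p dvd coeff f i" unfolding i_def by (rule LeastI) fact
  have il: "p dvd coeff f j" if "j < i" for j using not_less_Least[OF that[unfolded i_def]] by blast
  have ideg: "i \<le> degree f" unfolding i_def by (rule Least_le) fact
  have "coeff (f * h) i = (\<Sum>j<i. coeff f j * coeff h (i - j)) + coeff f i * coeff h 0"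
    by (simp add: coeff_mult lessThan_Suc_atMost[symmetric])
  moreover have "p dvd (\<Sum>j<i. coeff f j * coeff h (i - j))" using il by (intro dvd_sum) auto
  moreover have "\<not> p dvd coeff f i * coeff h 0" using i h0 p by (simp add: prime_dvd_mult_iff)
  ultimately have "\<not> p dvd coeff (f * h) i" by (simp add: dvd_add_right_iff)
  then have "i \<ge> degree (f * h)" using F not_le by blast
  then show ?thesis using ideg nz by (simp add: degree_mult_eq)
qed

text \<open>Since \<open>p\<^sup>2\<close> does not divide the constant coefficient of the product,
  one of the factors has a constant coefficient prime to \<open>p\<close>.\<close>

lemma eisenstein_factor:
  fixes f h :: "int poly" and p :: int
  assumes p: "prime p" and F: "\<And>i. i < degree (f * h) \<Longrightarrow> p dvd coeff (f * h) i"
    and lc: "\<not> p dvd lead_coeff (f * h)" and c0: "\<not> p\<^sup>2 dvd coeff (f * h) 0"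
  shows "degree f = 0 \<or> degree h = 0"
proof -
  have "\<not> (p dvd coeff f 0 \<and> p dvd coeff h 0)"
    using c0 by (auto simp: coeff_mult_0 power2_eq_square intro: mult_dvd_mono)
  then show ?thesis
    using eisenstein_aux[OF p, of h f] eisenstein_aux[OF p, of f h] F lc by (auto simp: mult.commute)
qed

section \<open>Cyclotomic integers of prime power level\<close>

lemma cis_root_power_eq_1_iff:
  assumes "n > 0"
  shows "cis (2 * pi / real n) ^ k = 1 \<longleftrightarrow> n dvd k"
proof
  let ?z = "cis (2 * pi / real n)"
  have n1: "?z ^ n = 1" using assms by (simp add: DeMoivre)
  have e: "?z ^ k = ?z ^ (k mod n)" for k
  proof -
    have "?z ^ k = ?z ^ (n * (k div n) + k mod n)" by simp
    also have "\<dots> = ?z ^ (k mod n)" using n1 by (simp only: power_add power_mult) simp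
    finally show ?thesis .
  qed
  show "n dvd k" if "?z ^ k = 1"
  proof -
    have "cis (2 * pi * real (k mod n) / real n) = cis (2 * pi * real 0 / real n)"
      using that e[of k] by (simp add: DeMoivre mult.commute)
    moreover have "k mod n \<in> {..<n}" "0 \<in> {..<n}" using assms by auto
    ultimately have "k mod n = 0"
      using bij_betw_roots_unity[OF assms] by (meson bij_betw_def inj_onD)
    then show ?thesis by auto
  qed
  show "?z ^ k = 1" if "n dvd k" using that n1 by (auto simp: power_mult)
qed

locale odd_prime_power =
  fixes p b :: nat
  assumes prime_p: "prime p" and odd_p: "odd p" and b_pos: "b > 0"
begin

definition "n = p ^ b"
text \<open>The multiples of \<open>N\<close> form the subgroup of order \<open>p\<close> of Z/n, so
  residues modulo \<open>N\<close> index its cosets.\<close>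

definition "N = p ^ (b - 1)"
definition "\<zeta> = cis (2 * pi / real n)"

lemma n_eq: "n = p * N"
  unfolding n_def N_def using b_pos by (cases b) auto

lemma p_ge_3: "p \<ge> 3"
  using prime_ge_2_nat[OF prime_p] odd_p by (cases "p = 2") auto

lemma N_pos: "N > 0" and n_pos: "n > 0"
  using prime_gt_0_nat[OF prime_p] by (auto simp: N_def n_def)

lemma p_pos: "p > 0"
  using p_ge_3 by simp

lemma N_less_n: "N < n"
  using n_eq N_pos p_ge_3 by simp

lemma odd_n: "odd n"
  using odd_p by (simp add: n_def)

lemma coprime_n_iff: "coprime k n \<longleftrightarrow> \<not> p dvd k"
proof
  assume "coprime k n"
  then have "coprime k p" using b_pos by (simp add: n_def)
  then show "\<not> p dvd k" using coprime_common_divisor[of k p p] prime_p by auto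
next
  assume "\<not> p dvd k"
  then have "coprime p k" using prime_p by (rule prime_imp_coprime[rotated])
  then show "coprime k n" by (simp add: n_def coprime_commute)
qed

lemma zeta_power_eq_1_iff: "\<zeta> ^ k = 1 \<longleftrightarrow> n dvd k"
  unfolding \<zeta>_def by (rule cis_root_power_eq_1_iff[OF n_pos])

lemma zeta_nonzero [simp]: "\<zeta> \<noteq> 0"
  by (simp add: \<zeta>_def)

lemma zeta_power_n [simp]: "\<zeta> ^ n = 1"
  by (simp add: zeta_power_eq_1_iff)

lemma zeta_power_mod: "\<zeta> ^ (k mod n) = \<zeta> ^ k"
proof -
  have "\<zeta> ^ k = \<zeta> ^ (n * (k div n) + k mod n)" by simp
  also have "\<dots> = \<zeta> ^ (k mod n)" by (simp only: power_add power_mult) simp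
  finally show ?thesis by simp
qed

lemma zeta_power_cong: "[j = k] (mod n) \<Longrightarrow> \<zeta> ^ j = \<zeta> ^ k"
  by (metis cong_def zeta_power_mod)

lemma zeta_power_inj: "\<zeta> ^ j = \<zeta> ^ k \<Longrightarrow> [j = k] (mod n)"
proof (induction j k rule: linorder_wlog)
  case (le j k)
  then have "\<zeta> ^ j * \<zeta> ^ (k - j) = \<zeta> ^ j * 1" by (subst power_add[symmetric]) simp
  then have "\<zeta> ^ (k - j) = 1" by (subst (asm) mult_left_cancel) auto
  then have "n dvd k - j" by (simp add: zeta_power_eq_1_iff)
  then have "[k = j] (mod n)" using le by (simp add: cong_altdef_nat)
  then show ?case by (rule cong_sym)
next
  case (sym j k)
  then show ?case by (simp add: cong_sym_eq)
qed

lemma zeta_mult_cnj: "\<zeta> * cnj \<zeta> = 1"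
  by (simp add: \<zeta>_def cis_cnj cis_mult)

lemma zeta_power_mult_cnj: "\<zeta> ^ k * cnj (\<zeta> ^ k) = 1"
  unfolding complex_cnj_power power_mult_distrib[symmetric] zeta_mult_cnj by simp

lemma cnj_zeta: "cnj \<zeta> = \<zeta> ^ (n - 1)"
proof -
  have "\<zeta> * \<zeta> ^ (n - 1) = 1" using n_pos by (simp flip: power_Suc)
  then show ?thesis using zeta_mult_cnj by (metis mult_left_cancel zeta_nonzero)
qed

lemma not_p_dvd_n_minus_1: "\<not> p dvd n - 1"
proof
  assume "p dvd n - 1"
  moreover have "p dvd n" using n_eq by simp
  ultimately have "p dvd n - (n - 1)" by (rule dvd_diff_nat[rotated])
  then show False using n_pos p_ge_3 by simp
qed

section \<open>Irreducibility of the cyclotomic polynomial of level p^b\<close>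

text \<open>The cyclotomic polynomial \<open>(x^n - 1) / (x^N - 1)\<close>, written as a geometric
  sum in \<open>x^N\<close>.\<close>

definition Phi :: "int poly" where "Phi = (\<Sum>i<p. monom 1 (N * i))"

lemma ev_Phi:
  assumes "\<not> p dvd k"
  shows "ev (\<zeta> ^ k) Phi = 0"
proof -
  define w where "w = (\<zeta> ^ k) ^ N"
  have "w ^ p = (\<zeta> ^ n) ^ k" unfolding w_def n_eq by (simp flip: power_mult add: mult_ac)
  then have "w ^ p = 1" by simp
  moreover have "w \<noteq> 1"
    using assms N_pos unfolding w_def power_mult[symmetric] zeta_power_eq_1_iff n_eq by simp
  moreover have "ev (\<zeta> ^ k) Phi = (\<Sum>i<p. w ^ i)" by (simp add: Phi_def w_def power_mult)
  ultimately show ?thesis by (simp add: geometric_sum)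
qed

lemma coeff_Phi: "coeff Phi i = (if N dvd i \<and> i < n then 1 else 0)"
proof -
  have "coeff Phi i = (\<Sum>j<p. if N * j = i then 1 else 0)"
    by (simp add: Phi_def coeff_sum)
  also have "\<dots> = (if N dvd i \<and> i < n then 1 else 0)"
  proof (cases "N dvd i")
    case True
    then obtain j where j: "i = N * j" by auto
    have "(\<Sum>l<p. if N * l = i then 1 else (0::int)) = (\<Sum>l<p. if l = j then 1 else 0)"
      using N_pos j by (intro sum.cong) auto
    then show ?thesis using N_pos j by (simp add: n_eq)
  qed (auto intro!: sum.neutral)
  finally show ?thesis .
qed

lemma degree_Phi: "degree Phi = n - N" and lead_coeff_Phi: "lead_coeff Phi = 1"
proof -
  have c: "coeff Phi (n - N) = 1" using N_less_n N_pos by (simp add: coeff_Phi n_eq)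
  have "coeff Phi i = 0" if "i > n - N" for i
  proof (rule ccontr)
    assume "coeff Phi i \<noteq> 0"
    then have i: "N dvd i" "i < n" by (auto simp: coeff_Phi split: if_splits)
    then have "N dvd n - i" "n - i > 0" using n_eq by auto
    then have "N \<le> n - i" by (rule dvd_imp_le)
    then show False using that i by linarith
  qed
  then have "degree Phi \<le> n - N" by (intro degree_le) auto
  moreover have "n - N \<le> degree Phi" using c by (intro le_degree) auto
  ultimately show d: "degree Phi = n - N" by simp
  show "lead_coeff Phi = 1" using c d by simp
qed

lemma poly_Phi_1: "poly Phi 1 = int p"
  by (simp add: Phi_def poly_sum poly_monom)

lemma Phi_mult: "(monom 1 N - 1) * Phi = monom 1 n - 1"
proof -
  have "Phi = (\<Sum>i<p. monom 1 N ^ i)" by (simp add: Phi_def monom_power)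
  then have "(monom 1 N - 1) * Phi = monom 1 N ^ p - 1" by (simp only: power_diff_1_eq)
  then show ?thesis by (simp add: monom_power n_eq mult.commute)
qed

text \<open>Modulo \<open>p\<close>, \<open>(1 + x)^N - 1\<close> is \<open>x^N\<close> and
  \<open>(1 + x)^n - 1\<close> is \<open>x^n\<close>, so \<open>Phi(1 + x)\<close> is congruent to
  their quotient \<open>x^(n - N)\<close>.\<close>

lemma coeff_Phi_shifted:
  assumes "i < n - N"
  shows "int p dvd coeff (pcompose Phi [:1, 1:]) i"
proof -
  define F y where "F = pcompose Phi [:1, 1:]" and "y = [:1, 1::int:]"
  have fr: "of_nat p dvd y ^ (p ^ k) - 1 - monom 1 (p ^ k)" for k
    using frobenius_poly_iterated[OF prime_p, of y k] by (simp add: y_def pcompose_pCons algebra_simps one_pCons)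
  have "pcompose ((monom 1 N - 1) * Phi) [:1, 1:] = pcompose (monom 1 n - 1) [:1, 1:]"
    by (simp only: Phi_mult)
  then have eq: "(y ^ N - 1) * F = y ^ n - 1"
    by (simp add: pcompose_mult pcompose_diff pcompose_monom F_def y_def pcompose_1)
  have "monom 1 N * F - monom 1 n = (y ^ n - 1 - monom 1 n) - (y ^ N - 1 - monom 1 N) * F"
    unfolding eq[symmetric] by (simp add: algebra_simps)
  then have "of_nat p dvd monom 1 N * F - monom 1 n"
    using fr[of b] fr[of "b - 1"] unfolding n_def N_def by (simp only: dvd_diff dvd_mult2)
  then obtain Q where "monom 1 N * F - monom 1 n = of_nat p * Q" by blast
  then have "coeff (monom 1 N * F - monom 1 n) (N + i) = coeff (of_nat p * Q) (N + i)" by simp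
  then have "coeff F i = int p * coeff Q (N + i)"
    using assms by (simp add: coeff_monom_mult of_nat_poly split: if_splits)
  then show ?thesis unfolding F_def by simp
qed

text \<open>Eisenstein's criterion for \<open>Phi(1 + x)\<close>, whose constant coefficient is
  \<open>Phi(1) = p\<close>.\<close>

lemma Phi_factor:
  assumes "Phi = f * h"
  shows "degree f = 0 \<or> degree h = 0"
proof -
  let ?y = "[:1, 1::int:]"
  have eq: "pcompose f ?y * pcompose h ?y = pcompose Phi ?y"
    by (simp add: assms pcompose_mult)
  have d: "degree (pcompose Phi ?y) = n - N" by (simp add: degree_Phi degree_pcompose)
  have c: "coeff (pcompose Phi ?y) 0 = int p"
    using poly_pcompose[of Phi ?y 0] by (simp add: poly_0_coeff_0 poly_Phi_1)
  have "degree (pcompose f ?y) = 0 \<or> degree (pcompose h ?y) = 0"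
  proof (rule eisenstein_factor[of "int p"])
    show "prime (int p)" using prime_p by simp
    show "int p dvd coeff (pcompose f ?y * pcompose h ?y) i"
      if "i < degree (pcompose f ?y * pcompose h ?y)" for i
      using that coeff_Phi_shifted unfolding eq d by simp
    show "\<not> int p dvd lead_coeff (pcompose f ?y * pcompose h ?y)"
      unfolding eq using lead_coeff_comp[of ?y Phi] lead_coeff_Phi p_ge_3 by simp
    show "\<not> (int p)\<^sup>2 dvd coeff (pcompose f ?y * pcompose h ?y) 0"
      unfolding eq c power2_eq_square using p_ge_3 by (simp add: dvd_mult_cancel1)
  qed
  then show ?thesis by (simp add: degree_pcompose)
qed

text \<open>Gauss's lemma: the primitive part \<open>m\<close> of a nonzero polynomial of least
  degree vanishing at \<zeta> divides every integer polynomial vanishing there, in particular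
  \<open>Phi\<close>. As \<open>Phi\<close> is monic and has no proper factor, the cofactor is a
  unit.\<close>

lemma Phi_dvd:
  assumes "ev \<zeta> P = 0"
  shows "Phi dvd P"
proof -
  have ev0: "ev \<zeta> Phi = 0" using ev_Phi[of 1] p_ge_3 by simp
  have Phi0: "Phi \<noteq> 0" using lead_coeff_Phi by auto
  obtain u where u: "u \<noteq> 0" "ev \<zeta> u = 0"
    and umin: "\<And>v. v \<noteq> 0 \<Longrightarrow> ev \<zeta> v = 0 \<Longrightarrow> degree u \<le> degree v"
    using ex_has_least_nat[of "\<lambda>v. v \<noteq> 0 \<and> ev \<zeta> v = 0" Phi degree] ev0 Phi0 by blast
  define m where "m = primitive_part u"
  have cm: "content m = 1" using u by (simp add: m_def)
  have "of_int (content u) * ev \<zeta> m = ev \<zeta> (smult (content u) (primitive_part u))"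
    unfolding m_def by (rule ev_smult[symmetric])
  then have m: "ev \<zeta> m = 0" using u by simp
  have m0: "m \<noteq> 0" using cm by auto
  have dm: "degree m = degree u" by (simp add: m_def)
  have mdvd: "m dvd Q" if "ev \<zeta> Q = 0" for Q
  proof -
    obtain a q where aq: "a \<noteq> 0" "smult a Q = m * q + pseudo_mod Q m"
      using pseudo_mod(1)[OF m0] by blast
    have "ev \<zeta> (smult a Q) = 0" using that by simp
    then have "ev \<zeta> (pseudo_mod Q m) = 0" unfolding aq(2) using m by simp
    then have "pseudo_mod Q m = 0"
      using pseudo_mod(2)[OF m0, of Q] umin[of "pseudo_mod Q m"] dm by linarith
    with aq have eq: "smult a Q = m * q" by simp
    \<comment> \<open>Comparing contents shows that the multiplier \<open>a\<close> of the
      pseudo-division divides the quotient \<open>q\<close> and can be cancelled.\<close>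
    have "normalize a * content Q = content (smult a Q)" by simp
    also have "\<dots> = content q" unfolding eq by (simp add: content_mult cm)
    finally have "normalize a dvd content q" by (metis dvd_triv_left)
    then have "a dvd content q" by simp
    then have "[:a:] dvd q" by (simp add: const_poly_dvd_iff_dvd_content)
    then obtain q' where "q = [:a:] * q'" by blast
    with eq have "smult a Q = smult a (m * q')" by simp
    then have "Q = m * q'" using aq(1) by (metis smult_cancel)
    then show ?thesis by simp
  qed
  obtain h where h: "Phi = m * h" using mdvd[OF ev0] by blast
  have "degree m \<noteq> 0"
  proof
    assume "degree m = 0"
    then obtain c where c: "m = [:c:]" by (rule degree_eq_zeroE)
    with m m0 show False by simp
  qed
  then have "degree h = 0" using Phi_factor[OF h] by simp
  then obtain d where d: "h = [:d:]" by (rule degree_eq_zeroE)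
  have "lead_coeff m * d = 1" using lead_coeff_Phi unfolding h lead_coeff_mult by (simp add: d)
  then have "d dvd 1" by (metis dvd_triv_right)
  then have "h dvd 1" unfolding d by (simp add: is_unit_const_poly_iff)
  then have "Phi dvd m" unfolding h by (simp add: mult_unit_dvd_iff)
  then show ?thesis using mdvd[OF assms] dvd_trans by blast
qed

text \<open>This takes the place of the Galois action: every polynomial relation at \<zeta>^k
  carries over to \<zeta>^l. \<open>P(x^k)\<close> is a multiple of \<open>Phi\<close>, and it is
  evaluated at a power of \<zeta> whose \<open>k\<close>-th power is \<zeta>^l.\<close>

lemma ev_conjugate_eq_0:
  assumes "ev (\<zeta> ^ k) P = 0" "\<not> p dvd k" "\<not> p dvd l"
  shows "ev (\<zeta> ^ l) P = 0"
proof -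
  obtain k' where k': "[k * k' = 1] (mod n)"
    using cong_solve_coprime_nat[of k n] assms by (auto simp: coprime_n_iff)
  have "ev \<zeta> (pcompose P (monom 1 k)) = 0" using assms by simp
  then obtain Q where Q: "pcompose P (monom 1 k) = Phi * Q" using Phi_dvd by blast
  have "\<not> p dvd k' * l"
  proof -
    have "[k * k' = 1] (mod p)" using k' n_eq by (metis cong_modulus_mult_nat)
    then have "\<not> p dvd k'"
      by (metis cong_dvd_iff dvd_mult not_prime_unit prime_p)
    then show ?thesis using assms(3) prime_p by (simp add: prime_dvd_mult_iff)
  qed
  then have "ev (\<zeta> ^ (k' * l)) (pcompose P (monom 1 k)) = 0"
    unfolding Q by (simp add: ev_Phi)
  moreover have "\<zeta> ^ (k' * l * k) = \<zeta> ^ l"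
    using cong_scalar_right[OF k', of l] by (intro zeta_power_cong) (simp add: mult_ac)
  ultimately show ?thesis by (simp flip: power_mult)
qed

text \<open>Reduction modulo 1 - \<zeta> is \<open>P \<mapsto> P(1)\<close> modulo \<open>p\<close>,
  because \<open>Phi(1) = p\<close>.\<close>

lemma p_dvd_augmentation:
  assumes "ev \<zeta> P = (1 - \<zeta>) * ev \<zeta> Q"
  shows "int p dvd poly P 1"
proof -
  have "ev \<zeta> (P - [:1, -1:] * Q) = 0" using assms by (simp add: algebra_simps)
  then obtain R where R: "P - [:1, -1:] * Q = Phi * R" using Phi_dvd by blast
  have "poly P 1 = poly (P - [:1, -1:] * Q) 1" by simp
  also have "\<dots> = int p * poly R 1" unfolding R by (simp add: poly_Phi_1)
  finally show ?thesis by simp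
qed

section \<open>Removing the p-part of the norm\<close>

definition "units = {k. k < n \<and> \<not> p dvd k}"

lemma finite_units [simp]: "finite units"
  by (auto simp: units_def)

lemma card_units: "card units = n - N"
proof -
  have "{k. k < n \<and> p dvd k} = (\<lambda>i. p * i) ` {..<N}"
    using p_pos by (auto simp: n_eq)
  then have "card {k. k < n \<and> p dvd k} = N"
    using p_pos by (simp add: card_image inj_on_def)
  moreover have "card ({..<n} - {k. k < n \<and> p dvd k}) = card {..<n} - card {k. k < n \<and> p dvd k}"
    by (intro card_Diff_subset) auto
  moreover have "units = {..<n} - {k. k < n \<and> p dvd k}" by (auto simp: units_def)
  ultimately show ?thesis by simp
qed

lemma inj_on_zeta_power: "inj_on (\<lambda>k. \<zeta> ^ k) {..<n}"
  by (rule inj_onI) (auto dest!: zeta_power_inj simp: cong_def)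

text \<open>\<open>Phi\<close> is the product of the factors \<open>x - \<zeta>^k\<close> over the
  units: both sides are monic of degree \<open>n - N\<close> and agree at \<open>n - N\<close>
  points. The claim is the value at 1.\<close>

lemma prod_one_minus_zeta: "(\<Prod>k\<in>units. 1 - \<zeta> ^ k) = of_nat p"
proof -
  define R Q where "R = map_poly (of_int :: int \<Rightarrow> complex) Phi" and "Q = (\<Prod>k\<in>units. [:- (\<zeta> ^ k), 1:])"
  have dQ: "degree Q = n - N"
    unfolding Q_def by (subst degree_prod_eq_sum_degree) (auto simp: card_units)
  have "R = Q"
  proof (rule poly_eqI_degree_lead_coeff[where n = "n - N" and A = "(\<lambda>k. \<zeta> ^ k) ` units"])
    have "coeff R (n - N) = 1" using lead_coeff_Phi by (simp add: R_def coeff_map_poly degree_Phi)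
    moreover have "lead_coeff Q = 1" unfolding Q_def by (simp add: lead_coeff_prod)
    ultimately show "coeff R (n - N) = coeff Q (n - N)" using dQ by simp
    have "inj_on (\<lambda>k. \<zeta> ^ k) units" by (rule inj_on_subset[OF inj_on_zeta_power]) (auto simp: units_def)
    then show "n - N \<le> card ((\<lambda>k. \<zeta> ^ k) ` units)" by (simp add: card_image card_units)
    show "degree R \<le> n - N" unfolding R_def degree_Phi[symmetric] by (rule degree_le) (auto simp: coeff_map_poly coeff_eq_0)
    show "degree Q \<le> n - N" using dQ by simp
    fix z assume "z \<in> (\<lambda>k. \<zeta> ^ k) ` units"
    then obtain k where k: "k \<in> units" "z = \<zeta> ^ k" by auto
    have "poly R z = 0" using ev_Phi[of k] k by (simp add: ev_def R_def units_def)
    moreover have "poly Q z = 0" using k by (auto simp: Q_def poly_prod)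
    ultimately show "poly R z = poly Q z" by simp
  qed
  then have "poly Q 1 = ev 1 Phi" by (simp add: R_def ev_def)
  then show ?thesis by (simp add: Q_def poly_prod ev_at_1 poly_Phi_1)
qed

lemma one_minus_zeta_dvd: "\<exists>A. 1 - (\<zeta> ^ k) ^ l = (1 - \<zeta> ^ k) * ev \<zeta> A"
proof
  show "1 - (\<zeta> ^ k) ^ l = (1 - \<zeta> ^ k) * ev \<zeta> (\<Sum>i<l. monom 1 (k * i))"
    by (simp add: one_diff_power_eq power_mult)
qed

text \<open>Together with the preceding lemma this makes 1 - \<zeta> and 1 - \<zeta>^k associates:
  \<zeta> is itself a power of \<zeta>^k.\<close>

lemma one_minus_zeta_associated:
  assumes "\<not> p dvd k"
  shows "\<exists>A. 1 - \<zeta> = (1 - \<zeta> ^ k) * ev \<zeta> A"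
proof -
  obtain k' where k': "[k * k' = 1] (mod n)"
    using cong_solve_coprime_nat[of k n] assms by (auto simp: coprime_n_iff)
  have "(\<zeta> ^ k) ^ k' = \<zeta> ^ 1" unfolding power_mult[symmetric] using k' by (rule zeta_power_cong)
  then show ?thesis using one_minus_zeta_dvd[of k k'] by simp
qed

lemma p_eq_power_one_minus_zeta: "\<exists>A. of_nat p = (1 - \<zeta>) ^ (n - N) * ev \<zeta> A"
  using prod_ev_dvd[of units "\<lambda>k. 1 - \<zeta> ^ k" "\<lambda>_. 1 - \<zeta>" \<zeta>] one_minus_zeta_dvd[of 1]
  by (simp add: prod_one_minus_zeta card_units)

section \<open>Extracting an element of squared modulus p\<close>

text \<open>One representative of each pair of units \<open>k\<close>, \<open>n - k\<close>, which
  complex conjugation exchanges.\<close>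

definition "half = {k \<in> units. 2 * k < n}"

definition "half_prod = (\<Prod>k\<in>half. 1 - \<zeta> ^ k)"

lemma cnj_zeta_power:
  assumes "k \<le> n" shows "cnj (\<zeta> ^ k) = \<zeta> ^ (n - k)"
proof -
  have "\<zeta> ^ k * \<zeta> ^ (n - k) = 1" using assms by (subst power_add[symmetric]) simp
  then show ?thesis using zeta_power_mult_cnj[of k] by (metis mult_left_cancel zeta_nonzero power_not_zero)
qed

lemma units_split: "units = half \<union> (\<lambda>k. n - k) ` half" "half \<inter> (\<lambda>k. n - k) ` half = {}"
    and inj_on_reflect: "inj_on (\<lambda>k. n - k) half"
proof -
  have pn: "p dvd n" using n_eq by simp
  have refl: "n - k \<in> units" if "k \<in> units" for k
  proof -
    have k: "k < n" "\<not> p dvd k" using that by (auto simp: units_def)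
    have "\<not> p dvd n - k" using k pn by (metis dvd_diffD1 less_imp_le)
    moreover have "k \<noteq> 0" using k by (metis dvd_0_right)
    ultimately show ?thesis using k by (simp add: units_def)
  qed
  have "k \<in> (\<lambda>k. n - k) ` half" if "k \<in> units" "\<not> 2 * k < n" for k
  proof -
    have "2 * k \<noteq> n" using odd_n by (metis dvd_triv_left)
    then have "2 * (n - k) < n" using that by (auto simp: units_def)
    then have "n - k \<in> half" using that refl[of k] by (auto simp: half_def)
    moreover have "k = n - (n - k)" using that by (auto simp: units_def)
    ultimately show ?thesis by blast
  qed
  then show "units = half \<union> (\<lambda>k. n - k) ` half" using refl by (auto simp: half_def)
  show "half \<inter> (\<lambda>k. n - k) ` half = {}" by (auto simp: half_def)
  show "inj_on (\<lambda>k. n - k) half" by (auto simp: half_def inj_on_def)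
qed

lemma finite_half [simp]: "finite half"
  by (simp add: half_def)

lemma card_half: "2 * card half = n - N"
proof -
  have "card units = card half + card ((\<lambda>k. n - k) ` half)"
    using units_split(2) by (subst units_split(1)) (intro card_Un_disjoint, auto)
  then show ?thesis by (simp add: card_image inj_on_reflect card_units)
qed

lemma half_prod_mult_cnj: "half_prod * cnj half_prod = of_nat p"
proof -
  have "cnj half_prod = (\<Prod>k\<in>half. 1 - \<zeta> ^ (n - k))"
    unfolding half_prod_def cnj_prod by (intro prod.cong) (auto simp: half_def units_def cnj_zeta_power simp del: complex_cnj_power)
  also have "\<dots> = (\<Prod>k\<in>(\<lambda>k. n - k) ` half. 1 - \<zeta> ^ k)"
    by (simp add: prod.reindex inj_on_reflect)
  finally have "half_prod * cnj half_prod = (\<Prod>k\<in>half \<union> (\<lambda>k. n - k) ` half. 1 - \<zeta> ^ k)"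
    unfolding half_prod_def using units_split(2) by (subst prod.union_disjoint) auto
  then show ?thesis using prod_one_minus_zeta units_split(1) by simp
qed

lemma cnj_ev_zeta: "cnj (ev \<zeta> P) = ev \<zeta> (pcompose P (monom 1 (n - 1)))"
  by (simp add: cnj_ev cnj_zeta)

text \<open>\<open>Q\<close> and its complex conjugate have the same augmentation
  \<open>Q(1)\<close>, so \<open>p\<close> divides \<open>Q(1)\<^sup>2\<close> and hence
  \<open>Q(1)\<close>. Both \<open>Q - Q(1)\<close> and \<open>p\<close> are multiples of 1 -
  \<zeta>.\<close>

lemma one_minus_zeta_prime:
  assumes "ev \<zeta> Q * cnj (ev \<zeta> Q) = (1 - \<zeta>) * ev \<zeta> A"
  shows "\<exists>R. ev \<zeta> Q = (1 - \<zeta>) * ev \<zeta> R"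
proof -
  have "ev \<zeta> (Q * pcompose Q (monom 1 (n - 1))) = (1 - \<zeta>) * ev \<zeta> A"
    using assms by (simp add: cnj_ev_zeta)
  then have "int p dvd poly (Q * pcompose Q (monom 1 (n - 1))) 1"
    by (rule p_dvd_augmentation)
  then have "int p dvd poly Q 1"
    using prime_p by (simp add: poly_pcompose poly_monom prime_dvd_mult_iff)
  then obtain r where r: "poly Q 1 = int p * r" by auto
  have "poly (Q - [:poly Q 1:]) 1 = 0" by simp
  then obtain S where S: "Q - [:poly Q 1:] = [:-1, 1:] * S"
    unfolding poly_eq_0_iff_dvd by (auto elim: dvdE)
  obtain B where B: "of_nat p = (1 - \<zeta>) ^ (n - N) * ev \<zeta> B"
    using p_eq_power_one_minus_zeta by blast
  have "ev \<zeta> Q = ev \<zeta> (Q - [:poly Q 1:]) + of_int (poly Q 1)" by simp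
  also have "ev \<zeta> (Q - [:poly Q 1:]) = (\<zeta> - 1) * ev \<zeta> S" unfolding S by (simp add: algebra_simps)
  also have "of_int (poly Q 1) = of_nat p * (of_int r :: complex)" by (simp add: r)
  also have "of_nat p = (1 - \<zeta>) * ((1 - \<zeta>) ^ (n - N - 1) * ev \<zeta> B)"
  proof -
    have "n - N = Suc (n - N - 1)" using N_less_n by simp
    then show ?thesis using B by (metis mult.assoc power_Suc)
  qed
  also have "(\<zeta> - 1) * ev \<zeta> S + (1 - \<zeta>) * ((1 - \<zeta>) ^ (n - N - 1) * ev \<zeta> B) * of_int r =
     (1 - \<zeta>) * ev \<zeta> (smult r ([:1, -1:] ^ (n - N - 1) * B) - S)"
    by (simp add: algebra_simps)
  finally show ?thesis by blast
qed

lemma one_minus_zeta_nonzero: "1 - \<zeta> \<noteq> 0"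
  using zeta_power_eq_1_iff[of 1] N_less_n N_pos by auto

text \<open>\<open>p\<close> is a multiple of (1 - \<zeta>)^(2 * card half). After \<open>k\<close>
  factors 1 - \<zeta> and their conjugates have been cancelled, a factor 1 - \<zeta> is left on the
  right, and primality yields the next one.\<close>

lemma norm_p_divisible:
  assumes X: "ev \<zeta> P * cnj (ev \<zeta> P) = of_nat p * of_nat M" and "k \<le> card half"
  shows "\<exists>Q. ev \<zeta> P = (1 - \<zeta>) ^ k * ev \<zeta> Q"
  using assms(2)
proof (induction k)
  case 0
  show ?case by auto
next
  case (Suc k)
  then obtain Q where Q: "ev \<zeta> P = (1 - \<zeta>) ^ k * ev \<zeta> Q" by auto
  define pi' where "pi' = 1 - \<zeta>"
  have pi0: "pi' \<noteq> 0" "cnj pi' \<noteq> 0" using one_minus_zeta_nonzero by (auto simp: pi'_def)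
  \<comment> \<open>1 - \<zeta> is a multiple of its conjugate, so \<open>k\<close> of the factors
    in \<open>p\<close> can be traded for conjugate ones.\<close>
  obtain W where "1 - \<zeta> = (1 - \<zeta> ^ (n - 1)) * ev \<zeta> W"
    using one_minus_zeta_associated[OF not_p_dvd_n_minus_1] by blast
  moreover have "cnj pi' = 1 - \<zeta> ^ (n - 1)" by (simp add: pi'_def cnj_zeta)
  ultimately have W: "pi' = cnj pi' * ev \<zeta> W" unfolding pi'_def by simp
  obtain A where "of_nat p = (1 - \<zeta>) ^ (n - N) * ev \<zeta> A"
    using p_eq_power_one_minus_zeta by blast
  moreover have "n - N = k + (k + (1 + (n - N - 2 * k - 1)))"
    using Suc.prems card_half by simp
  ultimately have "of_nat p = pi' ^ (k + (k + (1 + (n - N - 2 * k - 1)))) * ev \<zeta> A"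
    unfolding pi'_def by metis
  then have p: "of_nat p = pi' ^ k * pi' ^ k * (pi' * pi' ^ (n - N - 2 * k - 1) * ev \<zeta> A)"
    unfolding power_add by (simp add: mult_ac)
  have pk: "pi' ^ k = cnj pi' ^ k * ev \<zeta> W ^ k" by (subst W) (rule power_mult_distrib)
  have "pi' ^ k * cnj pi' ^ k * (ev \<zeta> Q * cnj (ev \<zeta> Q)) = of_nat p * of_nat M"
    unfolding X[symmetric] Q by (simp add: pi'_def mult_ac)
  also have "\<dots> = pi' ^ k * (cnj pi' ^ k * ev \<zeta> W ^ k) * (pi' * pi' ^ (n - N - 2 * k - 1) * ev \<zeta> A) * of_nat M"
    unfolding p pk[symmetric] ..
  finally have "pi' ^ k * cnj pi' ^ k * (ev \<zeta> Q * cnj (ev \<zeta> Q)) =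
      pi' ^ k * cnj pi' ^ k * (pi' * (ev \<zeta> W ^ k * pi' ^ (n - N - 2 * k - 1) * ev \<zeta> A * of_nat M))"
    by (simp only: mult_ac)
  then have "ev \<zeta> Q * cnj (ev \<zeta> Q) =
     pi' * (ev \<zeta> W ^ k * pi' ^ (n - N - 2 * k - 1) * ev \<zeta> A * of_nat M)"
    using pi0 by (subst (asm) mult_left_cancel) auto
  also have "\<dots> = (1 - \<zeta>) * ev \<zeta> (W ^ k * [:1, -1:] ^ (n - N - 2 * k - 1) * A * of_nat M)"
    by (simp add: pi'_def)
  finally obtain R where "ev \<zeta> Q = (1 - \<zeta>) * ev \<zeta> R" using one_minus_zeta_prime by blast
  with Q have "ev \<zeta> P = (1 - \<zeta>) ^ Suc k * ev \<zeta> R" by simp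
  then show ?case by blast
qed

text \<open>(1 - \<zeta>)^(card half) is a multiple of \<open>half_prod\<close>, whose squared
  modulus is \<open>p\<close>. Dividing by \<open>half_prod\<close> therefore removes exactly
  \<open>p\<close> from the squared modulus.\<close>

lemma norm_divide_p:
  assumes X: "ev \<zeta> P * cnj (ev \<zeta> P) = of_nat p * of_nat M"
  shows "\<exists>Q. ev \<zeta> Q * cnj (ev \<zeta> Q) = of_nat M"
proof -
  obtain Q where Q: "ev \<zeta> P = (1 - \<zeta>) ^ card half * ev \<zeta> Q"
    using norm_p_divisible[OF X, of "card half"] by auto
  have "\<exists>B. (\<Prod>k\<in>half. 1 - \<zeta>) = (\<Prod>k\<in>half. 1 - \<zeta> ^ k) * ev \<zeta> B"
    by (intro prod_ev_dvd one_minus_zeta_associated) (auto simp: half_def units_def)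
  then obtain B where B: "(1 - \<zeta>) ^ card half = half_prod * ev \<zeta> B" by (auto simp: half_prod_def)
  have "of_nat p * of_nat M = (half_prod * cnj half_prod) * (ev \<zeta> (B * Q) * cnj (ev \<zeta> (B * Q)))"
    unfolding X[symmetric] Q B by (simp add: mult_ac)
  then have "ev \<zeta> (B * Q) * cnj (ev \<zeta> (B * Q)) = of_nat M"
    using p_pos by (simp add: half_prod_mult_cnj)
  then show ?thesis by blast
qed

lemma norm_divide_p_power:
  assumes "ev \<zeta> P * cnj (ev \<zeta> P) = of_nat (p ^ c * M)"
  shows "\<exists>Q. ev \<zeta> Q * cnj (ev \<zeta> Q) = of_nat M"
  using assms
proof (induction c arbitrary: P)
  case (Suc c)
  then have "ev \<zeta> P * cnj (ev \<zeta> P) = of_nat p * of_nat (p ^ c * M)" by simp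
  from norm_divide_p[OF this] Suc.IH show ?case by blast
qed auto

end

section \<open>Sums of squared differences\<close>

text \<open>The variance of \<open>c\<close> on \<open>A\<close> times the square of
  \<open>card A\<close>, equivalently the sum of squared differences over unordered pairs.\<close>

definition spread :: "('a \<Rightarrow> int) \<Rightarrow> 'a set \<Rightarrow> int" where
  "spread c A = int (card A) * (\<Sum>i\<in>A. (c i)\<^sup>2) - (\<Sum>i\<in>A. c i)\<^sup>2"

lemma spread_eq: "2 * spread c A = (\<Sum>i\<in>A. \<Sum>j\<in>A. (c i - c j)\<^sup>2)"
proof -
  have "(\<Sum>i\<in>A. \<Sum>j\<in>A. (c i - c j)\<^sup>2) = (\<Sum>i\<in>A. \<Sum>j\<in>A. (c i)\<^sup>2 + (c j)\<^sup>2 - 2 * (c i * c j))"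
    by (intro sum.cong refl) (simp add: power2_diff)
  also have "\<dots> = 2 * spread c A"
    by (simp add: sum_subtractf sum.distrib sum_distrib_left[symmetric] sum_distrib_right[symmetric]
        spread_def power2_eq_square)
  finally show ?thesis by simp
qed

lemma spread_nonneg: "spread c A \<ge> 0"
proof -
  have "2 * spread c A \<ge> 0" unfolding spread_eq by (intro sum_nonneg) auto
  then show ?thesis by simp
qed

lemma spread_shift: "spread (\<lambda>i. c i - v) A = spread c A"
proof -
  have "2 * spread (\<lambda>i. c i - v) A = 2 * spread c A" unfolding spread_eq by simp
  then show ?thesis by simp
qed

text \<open>Only differences are compared, because a coefficient vector is determined by its element
  of Z[\<zeta>] only up to a constant on each coset.\<close>

lemma spread_reindex:
  assumes "bij_betw h A B" "\<And>i j. i \<in> A \<Longrightarrow> j \<in> A \<Longrightarrow> c (h i) - c (h j) = c i - c j"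
  shows "spread c B = spread c A"
proof -
  have "2 * spread c B = (\<Sum>i\<in>A. \<Sum>j\<in>A. (c (h i) - c (h j))\<^sup>2)"
    unfolding spread_eq by (simp add: sum.reindex_bij_betw[OF assms(1), symmetric])
  also have "\<dots> = 2 * spread c A" unfolding spread_eq using assms(2) by (intro sum.cong) auto
  finally show ?thesis by simp
qed

text \<open>Each pair of an element of \<open>S\<close> and an element outside \<open>S\<close>
  contributes at least 1.\<close>

lemma spread_ge_split:
  assumes fin: "finite A" and "S \<subseteq> A" and ne: "\<And>i j. i \<in> S \<Longrightarrow> j \<in> A - S \<Longrightarrow> c i \<noteq> c j"
  shows "spread c A \<ge> int (card S) * (int (card A) - int (card S))"
proof -
  define T where "T = A - S"
  have fS: "finite S" "finite T" using assms finite_subset by (auto simp: T_def)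
  have cT: "int (card T) = int (card A) - int (card S)"
    using assms fS by (simp add: T_def card_Diff_subset of_nat_diff card_mono)
  let ?f = "\<lambda>i j. (c i - c j)\<^sup>2"
  have A: "A = S \<union> T" "S \<inter> T = {}" using assms(2) by (auto simp: T_def)
  have ge: "(\<Sum>i\<in>X. \<Sum>j\<in>Y. ?f i j) \<ge> int (card X) * int (card Y)"
    if "\<And>i j. i \<in> X \<Longrightarrow> j \<in> Y \<Longrightarrow> c i \<noteq> c j" for X Y
  proof -
    have "int (card X) * int (card Y) = (\<Sum>i\<in>X. \<Sum>j\<in>Y. 1)" by simp
    also have "\<dots> \<le> (\<Sum>i\<in>X. \<Sum>j\<in>Y. ?f i j)"
    proof (intro sum_mono)
      fix i j assume "i \<in> X" "j \<in> Y"
      then have "c i - c j \<noteq> 0" using that by auto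
      then have "(c i - c j)\<^sup>2 > 0" by (simp only: zero_less_power2 not_False_eq_True)
      then show "1 \<le> (c i - c j)\<^sup>2" by linarith
    qed
    finally show ?thesis .
  qed
  have nn: "(\<Sum>i\<in>X. \<Sum>j\<in>Y. ?f i j) \<ge> 0" for X Y by (intro sum_nonneg) auto
  have "2 * spread c A = (\<Sum>i\<in>S. \<Sum>j\<in>S. ?f i j) + (\<Sum>i\<in>S. \<Sum>j\<in>T. ?f i j)
      + (\<Sum>i\<in>T. \<Sum>j\<in>S. ?f i j) + (\<Sum>i\<in>T. \<Sum>j\<in>T. ?f i j)"
    unfolding spread_eq using fS A(2) by (simp add: A(1) sum.union_disjoint sum.distrib)
  moreover have "(\<Sum>i\<in>S. \<Sum>j\<in>T. ?f i j) \<ge> int (card S) * int (card T)"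
    using ne by (intro ge) (auto simp: T_def)
  moreover have "(\<Sum>i\<in>T. \<Sum>j\<in>S. ?f i j) \<ge> int (card T) * int (card S)"
  proof (intro ge)
    show "c i \<noteq> c j" if "i \<in> T" "j \<in> S" for i j using ne[of j i] that by (auto simp: T_def)
  qed
  moreover note nn[of S S] nn[of T T]
  ultimately have "2 * spread c A \<ge> 2 * (int (card S) * int (card T))" by (simp add: mult.commute)
  then show ?thesis by (simp add: cT)
qed

lemma mult_diff_mono:
  fixes a s m :: int
  assumes "a \<le> s" "s \<le> m - a"
  shows "a * (m - a) \<le> s * (m - s)"
proof -
  have "s * (m - s) - a * (m - a) = (s - a) * (m - a - s)" by (simp add: algebra_simps)
  then show ?thesis using assms by (smt (verit) mult_nonneg_nonneg)
qed

lemma spread_ge_value_class: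
  assumes "finite A"
  shows "spread c A \<ge> int (card {i \<in> A. c i = v}) * (int (card A) - int (card {i \<in> A. c i = v}))"
  by (rule spread_ge_split) (use assms in auto)

text \<open>The value class of \<open>i\<close> has size \<open>s\<close> between 1 and
  \<open>card A - 1\<close>, and \<open>s * (card A - s)\<close> is least at these two ends.\<close>

lemma spread_ge_nonconst:
  assumes fin: "finite A" and ij: "i \<in> A" "j \<in> A" "c i \<noteq> c j"
  shows "spread c A \<ge> int (card A) - 1"
proof -
  define S where "S = {k \<in> A. c k = c i}"
  have S: "S \<subseteq> A - {j}" "i \<in> S" using ij by (auto simp: S_def)
  have fS: "finite S" using fin by (simp add: S_def)
  have "card S \<ge> 1" using S fS by (simp add: Suc_le_eq card_gt_0_iff) auto
  moreover have "card S \<le> card (A - {j})" using S fin by (intro card_mono) auto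
  then have "card S < card A" using ij fin by (meson card_Diff1_less le_less_trans)
  ultimately have "1 * (int (card A) - 1) \<le> int (card S) * (int (card A) - int (card S))"
    by (intro mult_diff_mono) auto
  also have "\<dots> \<le> spread c A" unfolding S_def by (rule spread_ge_value_class[OF fin])
  finally show ?thesis by simp
qed

lemma spread_one_off:
  assumes fin: "finite A" and "i \<in> A" and v: "\<And>j. j \<in> A - {i} \<Longrightarrow> c j = v"
  shows "spread c A = (int (card A) - 1) * (c i - v)\<^sup>2"
proof -
  have "(\<Sum>j\<in>A. (c j - v)\<^sup>2) = (c i - v)\<^sup>2 + (\<Sum>j\<in>A - {i}. (c j - v)\<^sup>2)"
    using assms by (simp add: sum.remove)
  moreover have "(\<Sum>j\<in>A - {i}. (c j - v)\<^sup>2) = 0" using v by (intro sum.neutral) auto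
  moreover have "(\<Sum>j\<in>A. c j - v) = (c i - v) + (\<Sum>j\<in>A - {i}. c j - v)"
    using assms by (simp add: sum.remove)
  moreover have "(\<Sum>j\<in>A - {i}. c j - v) = 0" using v by (intro sum.neutral) auto
  ultimately have "(\<Sum>j\<in>A. (c j - v)\<^sup>2) = (c i - v)\<^sup>2" "(\<Sum>j\<in>A. c j - v) = c i - v"
    by linarith+
  then have "spread (\<lambda>i. c i - v) A = (int (card A) - 1) * (c i - v)\<^sup>2"
    unfolding spread_def by (simp only: left_diff_distrib mult_1)
  then show ?thesis by (simp only: spread_shift)
qed

text \<open>The equality case of the bound for non-constant functions: a single value deviates, and
  by 1.\<close>

lemma spread_minimal:
  assumes fin: "finite A" and card: "card A \<ge> 3" and sp: "spread c A = int (card A) - 1"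
  obtains i v e where "i \<in> A" "c i = v + e" "e = 1 \<or> e = -1" "\<And>j. j \<in> A - {i} \<Longrightarrow> c j = v"
proof -
  \<comment> \<open>A value class of size between 2 and \<open>card A - 2\<close> would force a
    spread of at least \<open>2 * (card A - 2)\<close>, which is too large once
    \<open>card A\<close> exceeds 3.\<close>
  have cls: "card {k \<in> A. c k = c i} = 1 \<or> card {k \<in> A. c k = c i} \<ge> card A - 1" if "i \<in> A" for i
  proof (rule ccontr)
    assume neg: "\<not> ?thesis"
    have "card {k \<in> A. c k = c i} > 0" using that fin by (auto simp: card_gt_0_iff)
    with neg have "2 * (int (card A) - 2) \<le> int (card {k \<in> A. c k = c i}) * (int (card A) - int (card {k \<in> A. c k = c i}))"
      by (intro mult_diff_mono) auto
    with spread_ge_value_class[OF fin, of c "c i"] sp have "2 * (int (card A) - 2) \<le> int (card A) - 1" by linarith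
    then have "card A = 3" using card by arith
    then show False using neg \<open>card {k \<in> A. c k = c i} > 0\<close> by auto
  qed
  have "\<exists>i\<in>A. card {k \<in> A. c k = c i} \<noteq> 1"
  proof (rule ccontr)
    assume neg: "\<not> ?thesis"
    have "inj_on c A"
    proof (rule inj_onI)
      fix i j assume ij: "i \<in> A" "j \<in> A" "c i = c j"
      from neg ij obtain x where "{k \<in> A. c k = c i} = {x}" by (meson card_1_singletonE)
      moreover have "i \<in> {k \<in> A. c k = c i}" "j \<in> {k \<in> A. c k = c i}" using ij by auto
      ultimately show "i = j" by (metis singletonD)
    qed
    obtain i j k where ijk: "i \<in> A" "j \<in> A" "k \<in> A" "i \<noteq> j" "i \<noteq> k" "j \<noteq> k"
    proof -
      obtain B where "B \<subseteq> A" "card B = 3" using obtain_subset_with_card_n[OF card] by blast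
      then show ?thesis using that by (auto simp: card_3_iff)
    qed
    \<comment> \<open>If all values were distinct, a two-element set would already force
      \<open>card A = 3\<close>; then the six ordered pairs contribute at least 6 to twice the
      spread, which is only 4.\<close>
    have two: "int (card {i,j}) * (int (card A) - int (card {i,j})) \<le> spread c A"
      using \<open>inj_on c A\<close> ijk fin by (intro spread_ge_split) (auto dest: inj_onD)
    have "card {i, j} = 2" using ijk by simp
    then have "2 * (int (card A) - 2) \<le> int (card A) - 1" using two sp by simp
    then have c3: "card A = 3" using card by arith
    have "(\<Sum>x\<in>A. \<Sum>y\<in>A. (c x - c y)\<^sup>2) \<ge> (\<Sum>x\<in>A. \<Sum>y\<in>A. if x = y then 0 else 1)"
    proof (intro sum_mono)
      fix x y assume "x \<in> A" "y \<in> A"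
      then have "x \<noteq> y \<Longrightarrow> c x - c y \<noteq> 0" using \<open>inj_on c A\<close> by (auto dest: inj_onD)
      then have "x \<noteq> y \<Longrightarrow> (c x - c y)\<^sup>2 > 0" by (simp only: zero_less_power2 not_False_eq_True)
      then have "x \<noteq> y \<Longrightarrow> (c x - c y)\<^sup>2 \<ge> 1" by linarith
      then show "(if x = y then 0 else 1) \<le> (c x - c y)\<^sup>2" by auto
    qed
    moreover have "(\<Sum>x\<in>A. \<Sum>y\<in>A. if x = y then 0 else (1::int)) = (\<Sum>x\<in>A. \<Sum>y\<in>A. 1 - (if x = y then 1 else 0))"
      by (intro sum.cong) auto
    moreover have "\<dots> = 6" using fin c3 by (simp add: sum_subtractf)
    ultimately show False using sp c3 spread_eq[of c A] by simp
  qed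
  then obtain i where i: "i \<in> A" "card {k \<in> A. c k = c i} \<ge> card A - 1" using cls by blast
  define S where "S = {k \<in> A. c k = c i}"
  have "S \<noteq> A"
  proof
    assume "S = A"
    then have "\<And>j. j \<in> A - {i} \<Longrightarrow> c j = c i" by (auto simp: S_def)
    then have "spread c A = 0" using spread_one_off[OF fin i(1), of c "c i"] by simp
    then show False using sp card by simp
  qed
  have SA: "S \<subseteq> A" "finite S" using fin by (auto simp: S_def)
  then have "card S < card A" using \<open>S \<noteq> A\<close> fin by (simp add: psubset_card_mono psubset_eq)
  then have "card (A - S) = 1" using i SA by (simp add: S_def card_Diff_subset)
  then obtain k where k: "A - S = {k}" by (rule card_1_singletonE)
  have kv: "\<And>j. j \<in> A - {k} \<Longrightarrow> c j = c i" using k by (auto simp: S_def)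
  have kA: "k \<in> A" using k by auto
  have "(int (card A) - 1) * (c k - c i)\<^sup>2 = (int (card A) - 1) * 1"
    using spread_one_off[OF fin kA kv] sp by simp
  then have "(c k - c i)\<^sup>2 = 1" using card by (subst (asm) mult_left_cancel) auto
  then have "c k - c i = 1 \<or> c k - c i = -1" by (simp add: power2_eq_1_iff)
  then show ?thesis using that[of k "c i" "c k - c i"] kA kv by simp
qed

lemma abs_sum_le_sum_squares: "\<bar>\<Sum>i\<in>A. c i\<bar> \<le> (\<Sum>i\<in>A. (c i)\<^sup>2)" for c :: "'a \<Rightarrow> int"
proof -
  have "\<bar>x\<bar> \<le> x\<^sup>2" for x :: int
  proof (cases "x = 0")
    case False
    then have "\<bar>x\<bar> * 1 \<le> \<bar>x\<bar> * \<bar>x\<bar>" by (intro mult_left_mono) auto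
    then show ?thesis by (simp add: power2_eq_square abs_mult_self_eq)
  qed simp
  then have "(\<Sum>i\<in>A. \<bar>c i\<bar>) \<le> (\<Sum>i\<in>A. (c i)\<^sup>2)" by (intro sum_mono)
  then show ?thesis using sum_abs[of c A] by linarith
qed

section \<open>The trace identity\<close>

text \<open>Parseval's identity for the discrete Fourier transform on Z/n, by orthogonality of
  characters.\<close>

lemma parseval_cis:
  fixes f :: "nat \<Rightarrow> int"
  assumes "n > 0"
  defines "z \<equiv> cis (2 * pi / real n)"
  shows "(\<Sum>k<n. (\<Sum>i<n. of_int (f i) * z ^ (i * k)) * cnj (\<Sum>i<n. of_int (f i) * z ^ (i * k))) =
     of_int (int n * (\<Sum>i<n. (f i)\<^sup>2))"
proof -
  have z1: "z * cnj z = 1" by (simp add: z_def cis_cnj cis_mult)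
  have zn: "z ^ n = 1" using cis_root_power_eq_1_iff[OF assms(1), of n] by (simp add: z_def)
  have zc: "z ^ j * cnj z ^ j = 1" for j using z1 by (simp flip: power_mult_distrib)
  have inner: "(\<Sum>k<n. (z ^ i * cnj z ^ j) ^ k) = (if i = j then of_nat n else 0)"
    if "i < n" "j < n" for i j
  proof (cases "i = j")
    case True
    then show ?thesis by (simp add: zc)
  next
    case False
    have "z ^ i * cnj z ^ j \<noteq> 1"
    proof
      assume "z ^ i * cnj z ^ j = 1"
      then have "z ^ i * (z ^ j * cnj z ^ j) = z ^ j" by (metis mult.left_commute mult.right_neutral)
      then have "z ^ i = z ^ j" by (simp add: zc)
      then have "cis (2 * pi * real i / real n) = cis (2 * pi * real j / real n)"
        by (simp add: z_def DeMoivre mult.commute)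
      then show False using bij_betw_roots_unity[OF assms(1)] that False
        by (meson bij_betw_def inj_onD lessThan_iff)
    qed
    moreover have "(z ^ i * cnj z ^ j) ^ n = (z ^ n) ^ i * cnj (z ^ n) ^ j"
      unfolding power_mult_distrib complex_cnj_power power_mult[symmetric] by (simp only: mult.commute)
    ultimately show ?thesis using False by (simp add: geometric_sum zn)
  qed
  have "(\<Sum>k<n. (\<Sum>i<n. of_int (f i) * z ^ (i * k)) * cnj (\<Sum>i<n. of_int (f i) * z ^ (i * k)))
      = (\<Sum>k<n. \<Sum>i<n. \<Sum>j<n. of_int (f i) * of_int (f j) * (z ^ i * cnj z ^ j) ^ k)"
    by (simp add: sum_product power_mult_distrib mult_ac flip: power_mult)
  also have "\<dots> = (\<Sum>i<n. \<Sum>j<n. \<Sum>k<n. of_int (f i) * of_int (f j) * (z ^ i * cnj z ^ j) ^ k)"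
    by (subst sum.swap) (intro sum.cong refl sum.swap)
  also have "\<dots> = (\<Sum>i<n. \<Sum>j<n. if i = j then of_nat n * of_int (f i) * of_int (f j) else 0)"
    by (intro sum.cong refl) (auto simp: sum_distrib_left[symmetric] inner)
  also have "\<dots> = of_int (int n * (\<Sum>i<n. (f i)\<^sup>2))"
    by (simp add: sum_distrib_left power2_eq_square mult_ac)
  finally show ?thesis .
qed

context odd_prime_power begin

text \<open>For \<open>w < N\<close>, the coset of \<open>w\<close> modulo the subgroup of order
  \<open>p\<close> of Z/n.\<close>

definition "fibre w = {i. i < n \<and> i mod N = w}"

text \<open>The discrete Fourier transform of \<open>c\<close>. For \<open>k\<close> prime to
  \<open>p\<close> its values are conjugates of one element of Z[\<zeta>]; at multiples of
  \<open>p\<close> it depends only on the sums of \<open>c\<close> over the fibres.\<close>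

definition F :: "(nat \<Rightarrow> int) \<Rightarrow> nat \<Rightarrow> complex" where
  "F c k = (\<Sum>i<n. of_int (c i) * \<zeta> ^ (i * k))"

lemma finite_fibre [simp]: "finite (fibre w)"
  by (simp add: fibre_def)

lemma fibre_eq:
  assumes w: "w < N"
  shows "fibre w = (\<lambda>j. w + N * j) ` {..<p}"
proof (intro equalityI subsetI)
  fix i assume "i \<in> fibre w"
  then have i: "i < n" "i mod N = w" by (auto simp: fibre_def)
  then have "i = w + N * (i div N)" by (metis add.commute mult_div_mod_eq)
  moreover have "i div N < p" using i by (simp add: n_eq less_mult_imp_div_less)
  ultimately show "i \<in> (\<lambda>j. w + N * j) ` {..<p}" by blast
next
  fix i assume "i \<in> (\<lambda>j. w + N * j) ` {..<p}"
  then obtain j where j: "i = w + N * j" "j < p" by auto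
  then have "i < N * (j + 1)" using w by simp
  also have "\<dots> \<le> N * p" using j by (intro mult_left_mono) auto
  finally show "i \<in> fibre w" using j w by (simp add: fibre_def n_eq mult.commute)
qed

lemma card_fibre: "w < N \<Longrightarrow> card (fibre w) = p"
  using N_pos by (simp add: fibre_eq card_image inj_on_def)

lemma sum_fibres: "(\<Sum>i<n. f i) = (\<Sum>w<N. \<Sum>i\<in>fibre w. f i)"
proof -
  have "(\<Sum>w<N. sum f {i \<in> {..<n}. i mod N = w}) = (\<Sum>i<n. f i)"
    using N_pos by (intro sum.group) auto
  then show ?thesis by (simp add: fibre_def)
qed

lemma sum_zeta_fibre: "w < N \<Longrightarrow> (\<Sum>i\<in>fibre w. \<zeta> ^ i) = 0"
proof -
  assume w: "w < N"
  have "(\<Sum>i\<in>fibre w. \<zeta> ^ i) = (\<Sum>j<p. \<zeta> ^ (w + N * j))"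
    unfolding fibre_eq[OF w] using N_pos by (subst sum.reindex) (auto simp: inj_on_def)
  also have "\<dots> = \<zeta> ^ w * ev (\<zeta> ^ 1) Phi"
    by (simp add: Phi_def power_add sum_distrib_left)
  also have "\<dots> = 0" by (subst ev_Phi) (use p_ge_3 in auto)
  finally show ?thesis .
qed

lemma F_eq_ev: "F c k = ev (\<zeta> ^ k) (\<Sum>i<n. monom (c i) i)"
  by (simp add: F_def power_mult[symmetric] mult.commute)

text \<open>Exponents are reduced modulo \<open>n\<close>: multiplication by \<open>x\<close>
  rotates the coefficient vector cyclically. The same \<open>c\<close> serves all \<open>k\<close>
  at once.\<close>

lemma ev_eq_F: "\<exists>c. \<forall>k. ev (\<zeta> ^ k) P = F c k"
proof (induction P)
  case 0
  show ?case by (rule exI[of _ "\<lambda>_. 0"]) (simp add: F_def)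
next
  case (pCons a P)
  then obtain c where c: "\<And>k. ev (\<zeta> ^ k) P = F c k" by blast
  define d where "d i = (if i = 0 then a + c (n - 1) else c (i - 1))" for i
  obtain n' where n': "n = Suc n'" using n_pos by (cases n) auto
  have "ev (\<zeta> ^ k) (pCons a P) = F d k" for k
  proof -
    have "(\<zeta> ^ k) * F c k = (\<Sum>i<n. of_int (c i) * \<zeta> ^ (Suc i * k))"
      by (simp add: F_def sum_distrib_left power_add mult_ac)
    also have "\<dots> = (\<Sum>i<n'. of_int (c i) * \<zeta> ^ (Suc i * k)) + of_int (c n') * \<zeta> ^ (n * k)"
      by (simp add: n')
    also have "\<zeta> ^ (n * k) = 1" by (simp add: zeta_power_eq_1_iff)
    finally have "ev (\<zeta> ^ k) (pCons a P) = of_int (a + c n') + (\<Sum>i<n'. of_int (c i) * \<zeta> ^ (Suc i * k))"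
      by (simp add: c)
    also have "\<dots> = F d k"
      unfolding F_def n' sum.lessThan_Suc_shift by (simp add: d_def n')
    finally show ?thesis .
  qed
  then show ?case by blast
qed

text \<open>Parseval on Z/n covers all \<open>k < n\<close>. The multiples of \<open>p\<close> are
  accounted for by Parseval on Z/N for the fibre sums, and each of the remaining
  \<open>n - N\<close> values contributes \<open>m\<close>. Division by \<open>N\<close> gives the
  identity.\<close>

lemma trace_identity:
  assumes "\<And>k. \<not> p dvd k \<Longrightarrow> F c k * cnj (F c k) = of_nat m"
  shows "(\<Sum>w<N. spread c (fibre w)) = (int p - 1) * int m"
proof -
  define s where "s w = (\<Sum>i\<in>fibre w. c i)" for w
  have all: "(\<Sum>k<n. F c k * cnj (F c k)) = of_int (int n * (\<Sum>i<n. (c i)\<^sup>2))"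
    unfolding F_def \<zeta>_def by (rule parseval_cis[OF n_pos])
  have zN: "\<zeta> ^ p = cis (2 * pi / real N)"
    using p_pos by (simp add: \<zeta>_def DeMoivre n_eq)
  \<comment> \<open>Here \<zeta>^(p * i * k) depends only on \<open>i\<close> modulo
    \<open>N\<close>.\<close>
  have Fp: "F c (p * k) = (\<Sum>w<N. of_int (s w) * (\<zeta> ^ p) ^ (w * k))" for k
  proof -
    have "F c (p * k) = (\<Sum>w<N. \<Sum>i\<in>fibre w. of_int (c i) * \<zeta> ^ (i * (p * k)))"
      unfolding F_def by (rule sum_fibres)
    also have "\<dots> = (\<Sum>w<N. \<Sum>i\<in>fibre w. of_int (c i) * (\<zeta> ^ p) ^ (w * k))"
    proof (intro sum.cong refl)
      fix w i assume "i \<in> fibre w"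
      then have "i mod N = w" by (simp add: fibre_def)
      then have "[i = w] (mod N)" by (auto simp: cong_def)
      then have "[p * i = p * w] (mod n)" unfolding n_eq by (metis cong_cmult_leftI mult.commute)
      then have "[p * i * k = p * w * k] (mod n)" by (rule cong_scalar_right)
      then have "\<zeta> ^ (p * i * k) = \<zeta> ^ (p * w * k)" by (rule zeta_power_cong)
      then show "of_int (c i) * \<zeta> ^ (i * (p * k)) = of_int (c i) * (\<zeta> ^ p) ^ (w * k)"
        by (simp add: mult_ac flip: power_mult)
    qed
    finally show ?thesis by (simp add: s_def sum_distrib_right)
  qed
  have mult: "(\<Sum>k<N. F c (p * k) * cnj (F c (p * k))) = of_int (int N * (\<Sum>w<N. (s w)\<^sup>2))"
    unfolding Fp zN by (rule parseval_cis[OF N_pos])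
  have "{..<n} = units \<union> (\<lambda>k. p * k) ` {..<N}" "units \<inter> (\<lambda>k. p * k) ` {..<N} = {}"
    using p_pos by (auto simp: units_def n_eq)
  then have "(\<Sum>k<n. F c k * cnj (F c k)) = (\<Sum>k\<in>units. F c k * cnj (F c k))
      + (\<Sum>k\<in>(\<lambda>k. p * k) ` {..<N}. F c k * cnj (F c k))"
    by (simp add: sum.union_disjoint)
  also have "(\<Sum>k\<in>units. F c k * cnj (F c k)) = (\<Sum>k\<in>units. of_nat m)"
    using assms by (intro sum.cong) (auto simp: units_def)
  also have "\<dots> = of_int (int (n - N) * int m)" by (simp add: card_units)
  also have "(\<Sum>k\<in>(\<lambda>k. p * k) ` {..<N}. F c k * cnj (F c k)) = (\<Sum>k<N. F c (p * k) * cnj (F c (p * k)))"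
    using p_pos by (subst sum.reindex) (auto simp: inj_on_def)
  finally have "of_int (int n * (\<Sum>i<n. (c i)\<^sup>2)) =
      (of_int (int (n - N) * int m + int N * (\<Sum>w<N. (s w)\<^sup>2)) :: complex)"
    unfolding all mult of_int_add .
  then have "int n * (\<Sum>i<n. (c i)\<^sup>2) = int (n - N) * int m + int N * (\<Sum>w<N. (s w)\<^sup>2)"
    by (simp only: of_int_eq_iff)
  moreover have "int (n - N) = int N * (int p - 1)"
    using N_less_n by (simp add: n_eq of_nat_diff algebra_simps)
  moreover have "int n = int p * int N" by (simp add: n_eq)
  ultimately have "int N * (int p * (\<Sum>i<n. (c i)\<^sup>2)) = int N * ((int p - 1) * int m + (\<Sum>w<N. (s w)\<^sup>2))"
    by (simp only: distrib_left mult_ac)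
  then have e: "int p * (\<Sum>i<n. (c i)\<^sup>2) = (int p - 1) * int m + (\<Sum>w<N. (s w)\<^sup>2)"
    using N_pos by (subst (asm) mult_left_cancel) auto
  have "(\<Sum>w<N. spread c (fibre w)) = (\<Sum>w<N. int p * (\<Sum>i\<in>fibre w. (c i)\<^sup>2) - (s w)\<^sup>2)"
    by (intro sum.cong) (auto simp: spread_def card_fibre s_def)
  also have "\<dots> = int p * (\<Sum>i<n. (c i)\<^sup>2) - (\<Sum>w<N. (s w)\<^sup>2)"
    by (simp add: sum_subtractf sum_distrib_left sum_fibres)
  finally show ?thesis using e by simp
qed

lemma F_conjugate_eq_0:
  "F c k = 0 \<Longrightarrow> \<not> p dvd k \<Longrightarrow> \<not> p dvd l \<Longrightarrow> F c l = 0"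
  unfolding F_eq_ev by (rule ev_conjugate_eq_0)

text \<open>All conjugates vanish too, so the trace identity with \<open>m = 0\<close> makes every
  spread zero.\<close>

lemma F_eq_0_imp_const:
  assumes "F c k = 0" "\<not> p dvd k" "w < N" "i \<in> fibre w" "j \<in> fibre w"
  shows "c i = c j"
proof (rule ccontr)
  assume "c i \<noteq> c j"
  then have "spread c (fibre w) \<ge> int p - 1"
    using spread_ge_nonconst[of "fibre w" i j c] assms by (simp add: card_fibre)
  then have "spread c (fibre w) > 0" using p_ge_3 by linarith
  then have "(\<Sum>w<N. spread c (fibre w)) > 0"
    using assms(3) by (intro sum_pos2) (auto intro: spread_nonneg)
  moreover have "(\<Sum>w<N. spread c (fibre w)) = (int p - 1) * int 0"
    using F_conjugate_eq_0[OF assms(1,2)] by (intro trace_identity) auto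
  ultimately show False by simp
qed

text \<open>The sum of \<zeta>^i over a fibre is zero, so constants on fibres contribute nothing and
  only the deviation at \<open>k\<close> survives.\<close>

lemma F_one_off:
  assumes w: "w < N" "k \<in> fibre w" and off: "\<And>j. j \<in> fibre w - {k} \<Longrightarrow> c j = v"
    and const: "\<And>w' i j. w' < N \<Longrightarrow> w' \<noteq> w \<Longrightarrow> i \<in> fibre w' \<Longrightarrow> j \<in> fibre w' \<Longrightarrow> c i = c j"
  shows "F c 1 = of_int (c k - v) * \<zeta> ^ k"
proof -
  define G where "G w' = (\<Sum>i\<in>fibre w'. of_int (c i) * \<zeta> ^ i)" for w'
  have "F c 1 = (\<Sum>w'<N. G w')" unfolding F_def sum_fibres G_def by simp
  also have "\<dots> = G w + (\<Sum>w'\<in>{..<N} - {w}. G w')" using w by (simp add: sum.remove)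
  also have "(\<Sum>w'\<in>{..<N} - {w}. G w') = 0"
  proof (rule sum.neutral, rule ballI)
    fix w' assume w': "w' \<in> {..<N} - {w}"
    then have "w' \<in> fibre w'" using N_less_n by (auto simp: fibre_def)
    then have "G w' = (\<Sum>i\<in>fibre w'. of_int (c w') * \<zeta> ^ i)"
      unfolding G_def using const w' by (intro sum.cong) auto
    also have "\<dots> = of_int (c w') * (\<Sum>i\<in>fibre w'. \<zeta> ^ i)" by (simp add: sum_distrib_left)
    finally show "G w' = 0" using w' by (simp add: sum_zeta_fibre)
  qed
  also have "G w = (\<Sum>i\<in>fibre w. of_int v * \<zeta> ^ i + (if i = k then of_int (c k - v) * \<zeta> ^ k else 0))"
    unfolding G_def by (intro sum.cong) (auto simp: off algebra_simps)
  also have "\<dots> = of_int v * (\<Sum>i\<in>fibre w. \<zeta> ^ i) + of_int (c k - v) * \<zeta> ^ k"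
    using w by (simp add: sum.distrib sum_distrib_left)
  finally show ?thesis using w by (simp add: sum_zeta_fibre)
qed

lemma spread_fibre_ge:
  assumes "w < N" "spread c (fibre w) \<noteq> 0"
  shows "spread c (fibre w) \<ge> int p - 1"
proof -
  have w: "w \<in> fibre w" using N_less_n assms by (auto simp: fibre_def)
  have "\<exists>j\<in>fibre w. c j \<noteq> c w"
  proof (rule ccontr)
    assume "\<not> ?thesis"
    then have "\<And>j. j \<in> fibre w - {w} \<Longrightarrow> c j = c w" by blast
    from spread_one_off[OF finite_fibre w this] have "spread c (fibre w) = 0" by simp
    then show False using assms by simp
  qed
  then obtain j where "j \<in> fibre w" "c j \<noteq> c w" by blast
  then show ?thesis using spread_ge_nonconst[of "fibre w" j w c] w assms by (simp add: card_fibre)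
qed

text \<open>The spreads add up to \<open>p - 1\<close>, while each nonzero one is at least
  \<open>p - 1\<close>. So exactly one fibre is non-constant, and it attains the minimum.\<close>

lemma modulus_one_imp_root_of_unity:
  assumes "\<And>k. \<not> p dvd k \<Longrightarrow> ev (\<zeta> ^ k) P * cnj (ev (\<zeta> ^ k) P) = 1"
  obtains e :: int and i where "e = 1 \<or> e = -1" "ev \<zeta> P = of_int e * \<zeta> ^ i"
proof -
  obtain c where c: "\<And>k. ev (\<zeta> ^ k) P = F c k" using ev_eq_F by blast
  have tr: "(\<Sum>w<N. spread c (fibre w)) = (int p - 1) * int 1"
    using assms by (intro trace_identity) (simp add: c)
  have "\<exists>w\<in>{..<N}. spread c (fibre w) \<noteq> 0"
  proof (rule ccontr)
    assume "\<not> ?thesis"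
    then have "(\<Sum>w<N. spread c (fibre w)) = 0" by (intro sum.neutral) auto
    then show False using tr p_ge_3 by simp
  qed
  then obtain w where w: "w < N" "spread c (fibre w) \<noteq> 0" by auto
  have split: "(\<Sum>w<N. spread c (fibre w)) = spread c (fibre w) + (\<Sum>w'\<in>{..<N} - {w}. spread c (fibre w'))"
    using w by (simp add: sum.remove)
  have rest: "(\<Sum>w'\<in>{..<N} - {w}. spread c (fibre w')) = 0"
  proof -
    have "(\<Sum>w'\<in>{..<N} - {w}. spread c (fibre w')) \<ge> 0" by (intro sum_nonneg spread_nonneg)
    then show ?thesis using split tr spread_fibre_ge[OF w] unfolding of_nat_1 mult_1_right by linarith
  qed
  have const: "c i = c j" if "w' < N" "w' \<noteq> w" "i \<in> fibre w'" "j \<in> fibre w'" for w' i j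
  proof (rule ccontr)
    assume "c i \<noteq> c j"
    then have "spread c (fibre w') \<ge> int p - 1"
      using spread_ge_nonconst[of "fibre w'" i j c] that by (simp add: card_fibre)
    moreover have "spread c (fibre w') = 0"
      using rest that sum_nonneg_eq_0_iff[of "{..<N} - {w}" "\<lambda>w'. spread c (fibre w')"]
      by (simp add: spread_nonneg)
    ultimately show False using p_ge_3 by linarith
  qed
  have "spread c (fibre w) = int (card (fibre w)) - 1"
    using split rest tr w by (simp add: card_fibre)
  then obtain i v e where i: "i \<in> fibre w" "c i = v + e" "e = 1 \<or> e = -1"
    "\<And>j. j \<in> fibre w - {i} \<Longrightarrow> c j = v"
    using spread_minimal[of "fibre w" c] p_ge_3 w by (auto simp: card_fibre)
  have "F c 1 = of_int (c i - v) * \<zeta> ^ i"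
    by (rule F_one_off[OF w(1) i(1)]) (rule i(4), assumption, rule const)
  then have "ev \<zeta> P = of_int e * \<zeta> ^ i" using c[of 1] i(2) by simp
  then show ?thesis using that i(3) by blast
qed

section \<open>Primes different from p are unramified\<close>

definition zdvd :: "nat \<Rightarrow> complex \<Rightarrow> bool" where
  "zdvd k x \<longleftrightarrow> (\<exists>A. x = of_nat k * ev \<zeta> A)"

lemma zdvdI: "x = of_nat k * ev \<zeta> A \<Longrightarrow> zdvd k x"
  by (auto simp: zdvd_def)

lemma zdvd_add: "zdvd k x \<Longrightarrow> zdvd k y \<Longrightarrow> zdvd k (x + y)"
  unfolding zdvd_def by (metis distrib_left ev_add)

lemma zdvd_ev_mult: "zdvd k x \<Longrightarrow> zdvd k (x * ev (\<zeta> ^ j) P)"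
  unfolding zdvd_def by (metis ev_mult ev_pcompose_monom mult.assoc)

lemma zdvd_mult_cancel: "zdvd (j * k) (of_nat j * x) \<longleftrightarrow> zdvd k x" if "j > 0"
  using that by (auto simp: zdvd_def)

lemma zdvd_trans: "j dvd k \<Longrightarrow> zdvd k x \<Longrightarrow> zdvd j x"
proof -
  assume "j dvd k" "zdvd k x"
  then obtain i A where "k = j * i" "x = of_nat k * ev \<zeta> A" unfolding zdvd_def by (metis dvdE)
  then have "x = of_nat j * ev \<zeta> (of_nat i * A)" by simp
  then show ?thesis by (rule zdvdI)
qed

lemma zdvd_ev: "of_nat k dvd P \<Longrightarrow> zdvd k (ev (\<zeta> ^ j) P)"
proof -
  assume "of_nat k dvd P"
  then obtain Q where "P = of_nat k * Q" by blast
  then have "ev (\<zeta> ^ j) P = of_nat k * ev \<zeta> (pcompose Q (monom 1 j))" by simp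
  then show ?thesis by (rule zdvdI)
qed

lemma prime_not_p: "prime q \<Longrightarrow> q \<noteq> p \<Longrightarrow> \<not> p dvd q"
  using prime_p primes_dvd_imp_eq by blast

text \<open>A multiple of the order of \<open>q\<close> modulo \<open>n\<close>, made larger than
  \<open>a\<close> so that congruences modulo \<open>q^(l + 1)\<close> suffice for the exponent
  \<open>a + 1\<close>.\<close>

lemma power_cong_1:
  assumes "prime q" "q \<noteq> p"
  obtains l where "l > a" "[q ^ l = 1] (mod n)"
proof -
  have cop: "coprime n q" using prime_not_p[OF assms] by (simp add: coprime_n_iff coprime_commute)
  have "[q ^ (ord n q * Suc a) = 1] (mod n)" unfolding ord_divides by (rule dvd_triv_left)
  moreover have "ord n q * Suc a > a" using cop mult_le_mono1[of 1 "ord n q" "Suc a"] by (simp add: Suc_le_eq)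
  ultimately show ?thesis using that by blast
qed

text \<open>The \<open>l\<close>-fold Frobenius map fixes \<zeta>, so the \<open>q^l\<close>-th
  power map is the identity on Z[\<zeta>] modulo \<open>q\<close>.\<close>

lemma frobenius_fixed:
  assumes "prime q" "[q ^ l = 1] (mod n)"
  shows "zdvd q (ev \<zeta> Y - ev \<zeta> Y ^ (q ^ l))"
proof -
  have "of_nat q dvd - (Y ^ (q ^ l) - pcompose Y (monom 1 (q ^ l)))"
    using frobenius_poly_iterated[OF assms(1)] by (simp only: dvd_minus_iff)
  from zdvd_ev[OF this, of 1] have "zdvd q (ev (\<zeta> ^ (q ^ l)) Y - ev \<zeta> Y ^ (q ^ l))" by simp
  moreover have "\<zeta> ^ (q ^ l) = \<zeta>" using zeta_power_cong[OF assms(2)] by simp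
  ultimately show ?thesis by simp
qed

text \<open>
  Induction on \<open>a\<close>: for \<open>Q = q^l\<close> with \<open>q^l \<equiv> 1\<close> modulo \<open>n\<close>, the difference \<open>y - y^Q\<close> is a multiple of \<open>q\<close>, so
  the hypothesis for \<open>a - 1\<close> applies to the quotient. The remaining term is controlled by
  \<open>\<sigma>(y)^Q \<equiv> y^(q Q)\<close> modulo \<open>q^(l+1)\<close>.
\<close>

lemma zdvd_frobenius:
  assumes q: "prime q" "q \<noteq> p"
  shows "zdvd (q ^ a) (ev \<zeta> Y * ev \<zeta> Z) \<Longrightarrow> zdvd (q ^ a) (ev (\<zeta> ^ q) Y * ev \<zeta> Z)"
proof (induction a arbitrary: Y)
  case 0
  have "ev (\<zeta> ^ q) Y * ev \<zeta> Z = of_nat (q ^ 0) * ev \<zeta> (pcompose Y (monom 1 q) * Z)" by simp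
  then show ?case by (rule zdvdI)
next
  case (Suc a)
  obtain l where l: "l > a" "[q ^ l = 1] (mod n)" using power_cong_1[OF q] by blast
  define Q where "Q = q ^ l"
  have q0: "q > 0" using q prime_gt_0_nat by blast
  have Q: "Q > 0" using q0 by (simp add: Q_def)
  define y y' z where "y = ev \<zeta> Y" and "y' = ev (\<zeta> ^ q) Y" and "z = ev \<zeta> Z"
  obtain Y1 where Y1: "y - y ^ Q = of_nat q * ev \<zeta> Y1"
    using frobenius_fixed[OF q(1) l(2), of Y] by (auto simp: zdvd_def y_def Q_def)
  have yz: "zdvd (q ^ Suc a) (y * z)" using Suc.prems by (simp add: y_def z_def)
  have split: "y ^ k * z = (y * z) * ev (\<zeta> ^ 1) (Y ^ (k - 1))" if "k > 0" for k
    using that by (cases k) (simp_all add: y_def mult_ac)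
  have pow: "zdvd (q ^ Suc a) (y ^ k * z)" if "k > 0" for k
    unfolding split[OF that] by (rule zdvd_ev_mult[OF yz])
  have "zdvd (q ^ Suc a) (y * z + (- (y ^ Q * z)))"
  proof (rule zdvd_add[OF yz])
    show "zdvd (q ^ Suc a) (- (y ^ Q * z))"
      using zdvd_ev_mult[OF pow[OF Q], of 1 "- 1"] by simp
  qed
  moreover have "y * z + (- (y ^ Q * z)) = (y - y ^ Q) * z" by (simp add: algebra_simps)
  ultimately have "zdvd (q * q ^ a) (of_nat q * (ev \<zeta> Y1 * z))" by (simp add: Y1 mult.assoc)
  then have "zdvd (q ^ a) (ev \<zeta> Y1 * ev \<zeta> Z)" using q0 by (simp only: zdvd_mult_cancel z_def)
  then have "zdvd (q ^ a) (ev (\<zeta> ^ q) Y1 * z)" unfolding z_def by (rule Suc.IH)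
  then have "zdvd (q * q ^ a) (of_nat q * (ev (\<zeta> ^ q) Y1 * z))" using q0 by (simp only: zdvd_mult_cancel)
  \<comment> \<open>The relation that defines \<open>Y1\<close> is carried over to
    \<zeta>^q.\<close>
  moreover have "y' - y' ^ Q = of_nat q * ev (\<zeta> ^ q) Y1"
  proof -
    have "ev (\<zeta> ^ 1) (Y - Y ^ Q - of_nat q * Y1) = 0" using Y1 by (simp add: y_def)
    then have "ev (\<zeta> ^ q) (Y - Y ^ Q - of_nat q * Y1) = 0"
      by (rule ev_conjugate_eq_0) (use p_ge_3 prime_not_p[OF q] in auto)
    then show ?thesis by (simp add: y'_def)
  qed
  ultimately have *: "zdvd (q ^ Suc a) ((y' - y' ^ Q) * z)" by (simp add: mult.assoc)
  have "of_nat q dvd - (Y ^ q - pcompose Y (monom 1 q))"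
    using frobenius_poly[OF q(1)] by (simp only: dvd_minus_iff)
  then have "of_nat q dvd pcompose Y (monom 1 q) - Y ^ q" by simp
  from power_prime_power_cong[OF this, of l]
  have "of_nat (q ^ Suc l) dvd pcompose Y (monom 1 q) ^ Q - (Y ^ q) ^ Q" unfolding Q_def .
  from zdvd_ev[OF this, of 1] have "zdvd (q ^ Suc l) (y' ^ Q - y ^ (q * Q))"
    by (simp add: y'_def y_def power_mult)
  then have "zdvd (q ^ Suc a) (y' ^ Q - y ^ (q * Q))"
    by (rule zdvd_trans[rotated]) (use l in \<open>intro le_imp_power_dvd, simp\<close>)
  from zdvd_ev_mult[OF this, of 1 Z] have "zdvd (q ^ Suc a) ((y' ^ Q - y ^ (q * Q)) * z)"
    by (simp add: z_def)
  moreover have "zdvd (q ^ Suc a) (y ^ (q * Q) * z)" using q0 Q by (intro pow) simp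
  ultimately have "zdvd (q ^ Suc a) ((y' - y' ^ Q) * z + ((y' ^ Q - y ^ (q * Q)) * z + y ^ (q * Q) * z))"
    using * by (intro zdvd_add)
  moreover have "(y' - y' ^ Q) * z + ((y' ^ Q - y ^ (q * Q)) * z + y ^ (q * Q) * z) = y' * z"
    by (simp add: algebra_simps)
  ultimately show ?case by (simp add: y'_def z_def)
qed

lemma zdvd_frobenius_power:
  assumes q: "prime q" "q \<noteq> p" and "zdvd (q ^ a) (ev \<zeta> Y * ev \<zeta> Z)"
  shows "zdvd (q ^ a) (ev (\<zeta> ^ (q ^ j)) Y * ev \<zeta> Z)"
proof (induction j)
  case 0
  show ?case using assms by simp
next
  case (Suc j)
  then have "zdvd (q ^ a) (ev \<zeta> (pcompose Y (monom 1 (q ^ j))) * ev \<zeta> Z)" by simp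
  from zdvd_frobenius[OF q this] show ?case by (simp flip: power_mult)
qed

text \<open>Z[\<zeta>] modulo \<open>q\<close> is reduced: \<open>y\<close> is congruent to
  \<open>y^(q^l)\<close>, which is a multiple of \<open>y\<^sup>2\<close>.\<close>

lemma zdvd_prime_square_imp:
  assumes q: "prime q" "q \<noteq> p" and sq: "zdvd q (ev \<zeta> Y ^ 2)"
  shows "zdvd q (ev \<zeta> Y)"
proof -
  obtain l where l: "l > 0" "[q ^ l = 1] (mod n)" using power_cong_1[OF q] by blast
  have "q ^ 1 \<le> q ^ l" using l(1) q by (intro power_increasing) (auto simp: Suc_leI prime_gt_0_nat)
  then have "q ^ l \<ge> 2" using prime_ge_2_nat[OF q(1)] by simp
  then have "ev \<zeta> Y ^ (q ^ l) = ev \<zeta> Y ^ (2 + (q ^ l - 2))" by (simp only: le_add_diff_inverse)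
  also have "\<dots> = ev \<zeta> Y ^ 2 * ev (\<zeta> ^ 1) (Y ^ (q ^ l - 2))"
    unfolding power_add by simp
  finally have eq: "ev \<zeta> Y ^ (q ^ l) = ev \<zeta> Y ^ 2 * ev (\<zeta> ^ 1) (Y ^ (q ^ l - 2))" .
  have "zdvd q (ev \<zeta> Y ^ (q ^ l))" unfolding eq by (rule zdvd_ev_mult[OF sq])
  from zdvd_add[OF frobenius_fixed[OF q(1) l(2), of Y] this] show ?thesis by simp
qed

text \<open>One factor \<open>q\<close> of \<open>y\<close>, hence \<open>q\<^sup>2\<close> of its
  square, is removed at a time. The odd exponent \<open>2 * k + 1\<close> is rounded up to give
  \<open>k + 1\<close>.\<close>

lemma zdvd_square_imp:
  assumes q: "prime q" "q \<noteq> p"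
  shows "zdvd (q ^ (2 * k + 1)) (ev \<zeta> Y ^ 2) \<Longrightarrow> zdvd (q ^ (k + 1)) (ev \<zeta> Y)"
proof (induction k arbitrary: Y)
  case 0
  then show ?case using zdvd_prime_square_imp[OF q] by simp
next
  case (Suc k)
  have "zdvd q (ev \<zeta> Y ^ 2)" by (rule zdvd_trans[OF _ Suc.prems]) simp
  then have "zdvd q (ev \<zeta> Y)" by (rule zdvd_prime_square_imp[OF q])
  then obtain Y1 where Y1: "ev \<zeta> Y = of_nat q * ev \<zeta> Y1" by (auto simp: zdvd_def)
  have q0: "q > 0" using q prime_gt_0_nat by blast
  have "zdvd ((q ^ 2) * q ^ (2 * k + 1)) (of_nat (q ^ 2) * ev \<zeta> Y1 ^ 2)"
    using Suc.prems by (simp add: Y1 power_mult_distrib power2_eq_square mult_ac)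
  then have "zdvd (q ^ (2 * k + 1)) (ev \<zeta> Y1 ^ 2)" using q0 by (subst (asm) zdvd_mult_cancel) auto
  then have "zdvd (q ^ (k + 1)) (ev \<zeta> Y1)" by (rule Suc.IH)
  then have "zdvd (q * q ^ (k + 1)) (of_nat q * ev \<zeta> Y1)" using q0 by (subst zdvd_mult_cancel) auto
  then show ?case by (simp add: Y1)
qed

section \<open>Consequences for elements of squared modulus m\<close>

text \<open>The vanishing combination \<open>m - k * A\<close> has coefficients constant on fibres.
  Comparing positions 0 and \<open>N\<close> of fibre 0 exhibits \<open>m\<close> as an integer
  multiple of \<open>k\<close>.\<close>

lemma zdvd_of_nat:
  assumes "zdvd k (of_nat m)"
  shows "k dvd m"
proof -
  obtain A where A: "of_nat m = of_nat k * ev \<zeta> A" using assms by (auto simp: zdvd_def)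
  obtain c where c: "\<And>j. ev (\<zeta> ^ j) A = F c j" using ev_eq_F by blast
  define d where "d i = (if i = 0 then int m else 0) - int k * c i" for i
  have "F d 1 = (\<Sum>i<n. (if i = 0 then of_nat m else 0) - of_nat k * (of_int (c i) * \<zeta> ^ i))"
    unfolding F_def d_def by (intro sum.cong) (auto simp: algebra_simps)
  also have "\<dots> = of_nat m - of_nat k * F c 1"
    using n_pos by (simp add: sum_subtractf F_def sum_distrib_left)
  also have "\<dots> = 0" using A c[of 1] by simp
  finally have "F d 1 = 0" .
  moreover have "0 \<in> fibre 0" "N \<in> fibre 0" using N_less_n by (auto simp: fibre_def)
  ultimately have "d 0 = d N" using F_eq_0_imp_const[of d 1 0 0 N] p_ge_3 N_pos by simp
  then have "int m = int k * (c 0 - c N)" using N_pos by (simp add: d_def algebra_simps)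
  then have "int k dvd int m" by simp
  then show ?thesis by simp
qed

lemma zdvd_mult_coprime:
  assumes "zdvd j x" "zdvd k x" "coprime j k"
  shows "zdvd (j * k) x"
proof -
  obtain A B where A: "x = of_nat j * ev \<zeta> A" and B: "x = of_nat k * ev \<zeta> B"
    using assms unfolding zdvd_def by blast
  obtain u v where uv: "int j * u + int k * v = 1"
    using assms(3) bezout_int[of "int j" "int k"] by (auto simp: mult.commute)
  have "x = of_int (int j * u + int k * v) * x" unfolding uv by simp
  also have "\<dots> = of_int u * of_nat j * x + of_int v * of_nat k * x"
    by (simp add: algebra_simps)
  also have "\<dots> = of_int u * of_nat j * (of_nat k * ev \<zeta> B) + of_int v * of_nat k * (of_nat j * ev \<zeta> A)"
    using A B by simp
  also have "\<dots> = of_nat (j * k) * ev \<zeta> (smult u B + smult v A)" by (simp add: algebra_simps)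
  finally show ?thesis by (rule zdvdI)
qed

text \<open>Complex conjugation is \<zeta> \<mapsto> \<zeta>^(n - 1), so the value of the squared
  modulus is a polynomial relation at \<zeta> and passes to \<zeta>^k.\<close>

lemma norm_conjugate:
  assumes "ev \<zeta> Y * cnj (ev \<zeta> Y) = of_nat m" "\<not> p dvd k"
  shows "ev (\<zeta> ^ k) Y * cnj (ev (\<zeta> ^ k) Y) = of_nat m"
proof -
  have "ev (\<zeta> ^ 1) (Y * pcompose Y (monom 1 (n - 1)) - of_nat m) = 0"
    using assms by (simp add: cnj_ev_zeta)
  then have "ev (\<zeta> ^ k) (Y * pcompose Y (monom 1 (n - 1)) - of_nat m) = 0"
    by (rule ev_conjugate_eq_0) (use p_ge_3 assms in auto)
  moreover have "cnj (ev (\<zeta> ^ k) Y) = ev ((\<zeta> ^ k) ^ (n - 1)) Y"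
    by (simp add: cnj_ev cnj_zeta flip: power_mult) (simp add: mult.commute)
  ultimately show ?thesis by simp
qed

text \<open>The hypothesis on \<open>j\<close> makes complex conjugation a power of the Frobenius
  map of \<open>q\<close>. If \<open>q^(2 * k + 1)\<close> exactly divides \<open>m\<close>, it
  divides the square of \<open>cnj Y\<close>; so \<open>q^(k + 1)\<close> divides
  \<open>cnj Y\<close>, and \<open>q^(2 * k + 2)\<close> divides \<open>m\<close>, a
  contradiction.\<close>

lemma self_conjugate_even_multiplicity:
  assumes Y: "ev \<zeta> Y * cnj (ev \<zeta> Y) = of_nat m" and m: "m > 0" and q: "prime q" "q \<noteq> p"
    and j: "[q ^ j = n - 1] (mod n)"
  shows "even (multiplicity q m)"
proof (rule ccontr)
  assume "odd (multiplicity q m)"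
  then obtain k where k: "multiplicity q m = 2 * k + 1" by (rule oddE)
  define Z where "Z = pcompose Y (monom 1 (n - 1))"
  have Z: "ev \<zeta> Z = cnj (ev \<zeta> Y)" unfolding Z_def by (rule cnj_ev_zeta[symmetric])
  obtain m' where m': "m = q ^ (2 * k + 1) * m'" using multiplicity_dvd[of q m] k by auto
  have "ev \<zeta> Y * ev \<zeta> Z = of_nat (q ^ (2 * k + 1)) * ev \<zeta> (of_nat m')"
    using Y unfolding Z by (simp add: m')
  then have "zdvd (q ^ (2 * k + 1)) (ev \<zeta> Y * ev \<zeta> Z)" by (rule zdvdI)
  then have "zdvd (q ^ (2 * k + 1)) (ev (\<zeta> ^ (q ^ j)) Y * ev \<zeta> Z)" by (rule zdvd_frobenius_power[OF q])
  moreover have "ev (\<zeta> ^ (q ^ j)) Y = ev \<zeta> Z" using zeta_power_cong[OF j] by (simp add: Z_def)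
  ultimately have "zdvd (q ^ (2 * k + 1)) (ev \<zeta> Z ^ 2)" by (simp add: power2_eq_square)
  then have "zdvd (q ^ (k + 1)) (ev \<zeta> Z)" by (rule zdvd_square_imp[OF q])
  then obtain A where A: "ev \<zeta> Z = of_nat (q ^ (k + 1)) * ev \<zeta> A" by (auto simp: zdvd_def)
  have "ev \<zeta> Y = cnj (ev \<zeta> Z)" by (simp add: Z)
  then have "of_nat m = cnj (ev \<zeta> Z) * ev \<zeta> Z" using Y Z by simp
  also have "\<dots> = of_nat (q ^ (2 * (k + 1))) * (cnj (ev \<zeta> A) * ev \<zeta> A)"
    unfolding A by (simp add: power_mult power2_eq_square mult_ac power_mult_distrib)
  also have "cnj (ev \<zeta> A) * ev \<zeta> A = ev \<zeta> (pcompose A (monom 1 (n - 1)) * A)"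
    by (simp add: cnj_ev_zeta)
  finally have "zdvd (q ^ (2 * (k + 1))) (of_nat m)" by (rule zdvdI)
  then have "q ^ (2 * (k + 1)) dvd m" by (rule zdvd_of_nat)
  then have "2 * (k + 1) \<le> multiplicity q m"
    using m q by (intro multiplicity_geI) (auto dest: not_prime_unit)
  then show False using k by simp
qed

text \<open>For each prime \<open>q\<close> of \<open>m\<close> the map \<zeta> \<mapsto> \<zeta>^t
  is a power of Frobenius, so the full power of \<open>q\<close> in \<open>m\<close> divides
  \<sigma>(Y) * cnj Y. Hence \<open>m\<close> divides it, and all conjugates of the quotient have
  modulus 1.\<close>

lemma decomposition_semi_invariant:
  assumes Y: "ev \<zeta> Y * cnj (ev \<zeta> Y) = of_nat m" and m: "m > 0" "\<not> p dvd m" and pt: "\<not> p dvd t"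
    and t: "\<And>q. q \<in> prime_factors m \<Longrightarrow> \<exists>j. [t = q ^ j] (mod n)"
  obtains e :: int and i where "e = 1 \<or> e = -1" "ev (\<zeta> ^ t) Y = of_int e * \<zeta> ^ i * ev \<zeta> Y"
proof -
  define Z where "Z = pcompose Y (monom 1 (n - 1))"
  have Z: "ev \<zeta> Z = cnj (ev \<zeta> Y)" unfolding Z_def by (rule cnj_ev_zeta[symmetric])
  have loc: "zdvd (q ^ multiplicity q m) (ev (\<zeta> ^ t) Y * ev \<zeta> Z)" if qm: "q \<in> prime_factors m" for q
  proof -
    have q: "prime q" "q \<noteq> p" using qm m by (auto simp: in_prime_factors_iff)
    obtain j where j: "[t = q ^ j] (mod n)" using t[OF qm] by blast
    obtain m' where m': "m = q ^ multiplicity q m * m'" using multiplicity_dvd[of q m] by (rule dvdE)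
    have "ev \<zeta> Y * ev \<zeta> Z = of_nat m" using Y Z by simp
    also have "\<dots> = of_nat (q ^ multiplicity q m) * ev \<zeta> (of_nat m')"
      by (subst m') simp
    finally have "zdvd (q ^ multiplicity q m) (ev \<zeta> Y * ev \<zeta> Z)" by (rule zdvdI)
    from zdvd_frobenius_power[OF q this, of j] show ?thesis using zeta_power_cong[OF j] by simp
  qed
  have "zdvd (\<Prod>q\<in>S. q ^ multiplicity q m) (ev (\<zeta> ^ t) Y * ev \<zeta> Z)"
    if "finite S" "S \<subseteq> prime_factors m" for S
    using that
  proof (induction S rule: finite_induct)
    case empty
    have "ev (\<zeta> ^ t) Y * ev \<zeta> Z = of_nat 1 * ev \<zeta> (pcompose Y (monom 1 t) * Z)" by simp
    then show ?case unfolding prod.empty by (rule zdvdI)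
  next
    case (insert q S)
    have "coprime (q ^ multiplicity q m) (\<Prod>q\<in>S. q ^ multiplicity q m)"
    proof (rule prod_coprime_right)
      fix r assume "r \<in> S"
      then have "prime q" "prime r" "q \<noteq> r" using insert by (auto simp: in_prime_factors_iff)
      then have "coprime q r" by (rule primes_coprime)
      then show "coprime (q ^ multiplicity q m) (r ^ multiplicity r m)" by simp
    qed
    moreover have "zdvd (q ^ multiplicity q m) (ev (\<zeta> ^ t) Y * ev \<zeta> Z)" using insert by (intro loc) auto
    moreover have "zdvd (\<Prod>q\<in>S. q ^ multiplicity q m) (ev (\<zeta> ^ t) Y * ev \<zeta> Z)" using insert by auto
    ultimately show ?case unfolding prod.insert[OF insert(1,2)] by (intro zdvd_mult_coprime)
  qed
  from this[of "prime_factors m"] have "zdvd m (ev (\<zeta> ^ t) Y * ev \<zeta> Z)"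
    using m prime_factorization_nat[of m] by simp
  then obtain A where A: "ev (\<zeta> ^ t) Y * ev \<zeta> Z = of_nat m * ev \<zeta> A" by (auto simp: zdvd_def)
  \<comment> \<open>Both factors of the product, conjugated, have squared modulus \<open>m\<close>,
    so \<open>m\<close> times the quotient has squared modulus \<open>m\<^sup>2\<close>.\<close>
  have "ev (\<zeta> ^ k) A * cnj (ev (\<zeta> ^ k) A) = 1" if k: "\<not> p dvd k" for k
  proof -
    have "ev (\<zeta> ^ 1) (pcompose Y (monom 1 t) * Z - of_nat m * A) = 0" using A by simp
    then have "ev (\<zeta> ^ k) (pcompose Y (monom 1 t) * Z - of_nat m * A) = 0"
      by (rule ev_conjugate_eq_0) (use p_ge_3 k in auto)
    then have e: "ev (\<zeta> ^ (k * t)) Y * ev (\<zeta> ^ (k * (n - 1))) Y = of_nat m * ev (\<zeta> ^ k) A"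
      by (simp add: Z_def power_mult)
    have "\<not> p dvd k * t" "\<not> p dvd k * (n - 1)"
      using k pt not_p_dvd_n_minus_1 prime_p by (auto simp: prime_dvd_mult_iff)
    note N = norm_conjugate[OF Y this(1)] norm_conjugate[OF Y this(2)]
    have "of_nat m * of_nat m * (ev (\<zeta> ^ k) A * cnj (ev (\<zeta> ^ k) A)) =
       (of_nat m * ev (\<zeta> ^ k) A) * cnj (of_nat m * ev (\<zeta> ^ k) A)" by simp
    also have "\<dots> = (ev (\<zeta> ^ (k * t)) Y * cnj (ev (\<zeta> ^ (k * t)) Y)) *
       (ev (\<zeta> ^ (k * (n - 1))) Y * cnj (ev (\<zeta> ^ (k * (n - 1))) Y))"
      unfolding e[symmetric] complex_cnj_mult by (simp only: mult_ac)
    also have "\<dots> = of_nat m * of_nat m" unfolding N ..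
    finally show ?thesis using m by simp
  qed
  then obtain e :: int and i where e: "e = 1 \<or> e = -1" "ev \<zeta> A = of_int e * \<zeta> ^ i"
    using modulus_one_imp_root_of_unity by blast
  have "of_nat m * ev (\<zeta> ^ t) Y = (ev (\<zeta> ^ t) Y * ev \<zeta> Z) * ev \<zeta> Y"
    unfolding Y[symmetric] Z by (simp only: mult_ac)
  also have "\<dots> = of_nat m * (of_int e * \<zeta> ^ i * ev \<zeta> Y)" unfolding A e(2) by (simp only: mult_ac)
  finally have "ev (\<zeta> ^ t) Y = of_int e * \<zeta> ^ i * ev \<zeta> Y" using m by simp
  then show ?thesis using that e(1) by blast
qed

end

section \<open>The two bounds\<close>

text \<open>\<open>E\<close> is the sum of squares of the shifted coefficients; \<open>S\<close>,
  \<open>A\<close> and \<open>T\<close> are the sums of the fibre sums, of their absolute values and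
  of their squares. Writing \<open>E = m + L\<close> gives \<open>T = m + p * L\<close>; for
  \<open>p\<close> beyond the bound every value of \<open>L\<close> is excluded.\<close>

lemma planar_bound_arith:
  fixes p m A E T S :: int
  assumes m: "m \<ge> 2" and AE: "A \<le> E" and T: "p * E - T = (p - 1) * m" "0 \<le> T" "T \<le> A\<^sup>2"
    and A0: "0 \<le> A" and A: "(p + 1) * A \<le> 2 * ((p - 1) * m)"
    and S: "\<bar>S\<bar> \<le> A" "p dvd S\<^sup>2 - m" and sq: "S\<^sup>2 \<noteq> m"
  shows "p \<le> m\<^sup>2 + m + 1"
proof (rule ccontr)
  assume "\<not> ?thesis"
  then have p: "p \<ge> m\<^sup>2 + m + 2" by simp
  have mm: "m * m \<ge> 2 * m" using m by (intro mult_right_mono) auto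
  define L where "L = E - m"
  have TL: "T = m + p * L" using T(1) by (simp add: L_def algebra_simps)
  have p0: "p > m" "p > 0" using p m mm unfolding power2_eq_square by linarith+
  have "L \<ge> 0"
  proof (rule ccontr)
    assume "\<not> L \<ge> 0"
    then have "p * L \<le> p * (-1)" using p0 by (intro mult_left_mono) auto
    then show False using TL T(2) p0 by linarith
  qed
  moreover have "L \<noteq> 0"
  proof
    assume L0: "L = 0"
    then have "A \<le> m" using AE by (simp add: L_def)
    then have "\<bar>S\<bar> \<le> \<bar>m\<bar>" using S m by linarith
    then have Sm: "S\<^sup>2 \<le> m\<^sup>2" by (simp only: abs_le_square_iff)
    \<comment> \<open>\<open>S\<^sup>2\<close> lies between 0 and \<open>m\<^sup>2\<close>, so
      \<open>S\<^sup>2 - m\<close> is smaller than \<open>p\<close> in absolute value and must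
      vanish.\<close>
    obtain r where r: "S\<^sup>2 - m = p * r" using S(2) by blast
    have "r < 1"
    proof (rule ccontr)
      assume "\<not> r < 1"
      then have "p * 1 \<le> p * r" using p0 by (intro mult_left_mono) auto
      then show False using r Sm p m by linarith
    qed
    moreover have "r > -1"
    proof (rule ccontr)
      assume "\<not> r > -1"
      then have "p * r \<le> p * (-1)" using p0 by (intro mult_left_mono) auto
      then show False using r p0 zero_le_power2[of S] by linarith
    qed
    ultimately have "r = 0" by simp
    then show False using r sq by simp
  qed
  ultimately have L1: "L \<ge> 1" by simp
  have "A < 2 * m"
  proof (rule ccontr)
    assume "\<not> A < 2 * m"
    then have "(p + 1) * (2 * m) \<le> (p + 1) * A" using p0 by (intro mult_left_mono) auto
    then have "(p + 1) * (2 * m) \<le> 2 * ((p - 1) * m)" using A by linarith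
    then show False using m by (simp add: algebra_simps)
  qed
  then have "A\<^sup>2 \<le> (2 * m)\<^sup>2" using A0 by (intro power_mono) auto
  then have up: "m + p * L \<le> 4 * (m * m)" using T(3) TL by (simp add: power2_eq_square)
  have "A\<^sup>2 \<le> E\<^sup>2" using A0 AE by (intro power_mono) auto
  then have up2: "m + p * L \<le> (m + L)\<^sup>2" using T(3) TL by (simp add: L_def)
  have "L \<le> 3"
  proof (rule ccontr)
    assume "\<not> L \<le> 3"
    then have "p * 4 \<le> p * L" using p0 by (intro mult_left_mono) auto
    then show False using up p m by (simp add: power2_eq_square)
  qed
  then have "L = 1 \<or> L = 2 \<or> L = 3" using L1 by auto
  \<comment> \<open>The case \<open>L = 1\<close> is the tight one:
    \<open>m + p \<le> (m + 1)\<^sup>2\<close> is exactly the claimed bound.\<close>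
  then show False
    using up2 p m mm by (elim disjE) (auto simp: power2_eq_square algebra_simps)
qed

lemma sum_squares_le_square_sum_abs:
  fixes s :: "'a \<Rightarrow> int"
  assumes "finite A"
  shows "(\<Sum>i\<in>A. (s i)\<^sup>2) \<le> (\<Sum>i\<in>A. \<bar>s i\<bar>)\<^sup>2"
  using assms
proof (induction A rule: finite_induct)
  case (insert x A)
  have "0 \<le> \<bar>s x\<bar> * (\<Sum>i\<in>A. \<bar>s i\<bar>)" by (intro mult_nonneg_nonneg sum_nonneg) auto
  moreover have "(\<bar>s x\<bar> + (\<Sum>i\<in>A. \<bar>s i\<bar>))\<^sup>2 =
      (s x)\<^sup>2 + 2 * (\<bar>s x\<bar> * (\<Sum>i\<in>A. \<bar>s i\<bar>)) + (\<Sum>i\<in>A. \<bar>s i\<bar>)\<^sup>2"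
    by (simp add: power2_sum)
  ultimately have "(s x)\<^sup>2 + (\<Sum>i\<in>A. (s i)\<^sup>2) \<le> (\<bar>s x\<bar> + (\<Sum>i\<in>A. \<bar>s i\<bar>))\<^sup>2"
    using insert.IH by linarith
  then show ?case using insert by simp
qed simp

lemma is_square_int_imp: "(x::int)\<^sup>2 = int m \<Longrightarrow> is_square m"
proof -
  assume "x\<^sup>2 = int m"
  then have "int m = int ((nat \<bar>x\<bar>)\<^sup>2)" by simp
  then have "m = (nat \<bar>x\<bar>)\<^sup>2" by (simp only: of_nat_eq_iff)
  then show ?thesis by (simp add: is_nth_power_def)
qed

context odd_prime_power begin

text \<open>Subtracting a constant on a fibre changes its sum by a multiple of \<open>p\<close>, so
  the sum can be made the residue of least absolute value.\<close>

lemma fibre_shift_bound: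
  assumes w: "w < N"
  obtains k :: int where "2 * \<bar>(\<Sum>i\<in>fibre w. c i - k)\<bar> \<le> int p - 1"
proof -
  define h where "h = (int p - 1) div 2"
  have ph: "int p = 2 * h + 1" using odd_p unfolding h_def by presburger
  define s where "s = (\<Sum>i\<in>fibre w. c i)"
  define k where "k = (s + h) div int p"
  have "(\<Sum>i\<in>fibre w. c i - k) = s - int p * k"
    using w by (simp add: s_def sum_subtractf card_fibre)
  also have "\<dots> = (s + h) mod int p - h" unfolding k_def by (simp add: minus_mult_div_eq_mod[symmetric])
  finally have e: "(\<Sum>i\<in>fibre w. c i - k) = (s + h) mod int p - h" .
  define r where "r = (s + h) mod int p"
  have "r \<ge> 0" "r < int p" using p_pos by (auto simp: r_def)
  then have "r \<ge> 0" "r \<le> 2 * h" using ph by simp_all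
  then have "2 * \<bar>r - h\<bar> \<le> 2 * h" by (simp add: abs_le_iff)
  then have "2 * \<bar>(\<Sum>i\<in>fibre w. c i - k)\<bar> \<le> int p - 1" unfolding e r_def[symmetric] using ph by simp
  then show ?thesis by (rule that)
qed

text \<open>The augmentation of \<open>Y(x) * Y(x^(n - 1)) - m\<close>, which vanishes at
  \<zeta>.\<close>

lemma augmentation_square:
  assumes Y: "ev \<zeta> Y * cnj (ev \<zeta> Y) = of_nat m"
  shows "int p dvd (poly Y 1)\<^sup>2 - int m"
proof -
  have "ev \<zeta> (Y * pcompose Y (monom 1 (n - 1)) - of_nat m) = (1 - \<zeta>) * ev \<zeta> 0"
    using Y by (simp add: cnj_ev_zeta)
  from p_dvd_augmentation[OF this] show ?thesis
    by (simp add: poly_pcompose poly_monom power2_eq_square)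
qed

lemma planar_bound:
  assumes Y: "ev \<zeta> Y * cnj (ev \<zeta> Y) = of_nat m" and m: "m \<ge> 2" "\<not> is_square m"
  shows "p \<le> m\<^sup>2 + m + 1"
proof -
  obtain c where c: "\<And>k. ev (\<zeta> ^ k) Y = F c k" using ev_eq_F by blast
  have tr: "(\<Sum>w<N. spread c (fibre w)) = (int p - 1) * int m"
    using norm_conjugate[OF Y] by (intro trace_identity) (simp add: c)
  have "\<forall>w. \<exists>k. w < N \<longrightarrow> 2 * \<bar>(\<Sum>i\<in>fibre w. c i - k)\<bar> \<le> int p - 1"
    using fibre_shift_bound by metis
  then obtain k where k: "\<And>w. w < N \<Longrightarrow> 2 * \<bar>(\<Sum>i\<in>fibre w. c i - k w)\<bar> \<le> int p - 1" by metis
  define s where "s w = (\<Sum>i\<in>fibre w. c i - k w)" for w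
  define e where "e w = (\<Sum>i\<in>fibre w. (c i - k w)\<^sup>2)" for w
  have sp: "spread c (fibre w) = int p * e w - (s w)\<^sup>2" if "w < N" for w
    using spread_shift[of c "k w" "fibre w"] that by (simp add: spread_def s_def e_def card_fibre)
  have se: "\<bar>s w\<bar> \<le> e w" for w unfolding s_def e_def by (rule abs_sum_le_sum_squares)
  define A E T S where "A = (\<Sum>w<N. \<bar>s w\<bar>)" and "E = (\<Sum>w<N. e w)" and "T = (\<Sum>w<N. (s w)\<^sup>2)"
    and "S = (\<Sum>w<N. s w)"
  have ET: "int p * E - T = (int p - 1) * int m"
    unfolding tr[symmetric] E_def T_def by (simp add: sp sum_subtractf sum_distrib_left)
  have AE: "A \<le> E" unfolding A_def E_def using se by (intro sum_mono)
  \<comment> \<open>From \<open>2 * \<bar>s w\<bar> \<le> p - 1\<close> and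
    \<open>\<bar>s w\<bar> \<le> e w\<close>, twice the spread
    \<open>p * e w - (s w)\<^sup>2\<close> is at least
    \<open>(p + 1) * \<bar>s w\<bar>\<close>.\<close>
  have "(\<Sum>w<N. (int p + 1) * \<bar>s w\<bar>) \<le> (\<Sum>w<N. 2 * spread c (fibre w))"
  proof (intro sum_mono)
    fix w assume "w \<in> {..<N}"
    then have w: "w < N" by simp
    have "2 * \<bar>s w\<bar> \<le> int p - 1" using k[OF w] by (simp add: s_def)
    then have "\<bar>s w\<bar> * (2 * \<bar>s w\<bar>) \<le> \<bar>s w\<bar> * (int p - 1)" by (intro mult_left_mono) auto
    then have "2 * (s w)\<^sup>2 \<le> int p * \<bar>s w\<bar> - \<bar>s w\<bar>"
      by (simp add: power2_eq_square algebra_simps)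
    moreover have "int p * \<bar>s w\<bar> \<le> int p * e w" using se by (intro mult_left_mono) auto
    ultimately show "(int p + 1) * \<bar>s w\<bar> \<le> 2 * spread c (fibre w)"
      unfolding sp[OF w] by (simp add: algebra_simps)
  qed
  then have Abound: "(int p + 1) * A \<le> 2 * ((int p - 1) * int m)"
    unfolding tr[symmetric] A_def sum_distrib_left .
  \<comment> \<open>The shifts change the total only by multiples of \<open>p\<close>, so
    \<open>S\<close> inherits the congruence that \<open>Y(1)\<^sup>2\<close> satisfies.\<close>
  have "of_int (poly Y 1) = F c 0" using c[of 0] by (simp add: ev_at_1)
  then have "of_int (poly Y 1) = (of_int (\<Sum>i<n. c i) :: complex)" by (simp add: F_def)
  then have "poly Y 1 = (\<Sum>i<n. c i)" by (simp only: of_int_eq_iff)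
  also have "\<dots> = (\<Sum>w<N. \<Sum>i\<in>fibre w. c i)" by (rule sum_fibres)
  also have "\<dots> = (\<Sum>w<N. s w + int p * k w)"
    by (intro sum.cong) (auto simp: s_def sum_subtractf card_fibre)
  finally have "poly Y 1 = S + int p * (\<Sum>w<N. k w)"
    by (simp add: S_def sum.distrib sum_distrib_left)
  then have "int p dvd poly Y 1 - S" by simp
  then have "int p dvd (poly Y 1 - S) * (poly Y 1 + S)" by simp
  then have "int p dvd (poly Y 1)\<^sup>2 - S\<^sup>2" by (simp add: power2_eq_square algebra_simps)
  then have "int p dvd ((poly Y 1)\<^sup>2 - int m) - ((poly Y 1)\<^sup>2 - S\<^sup>2)"
    using augmentation_square[OF Y] by (rule dvd_diff[rotated])
  then have Sdvd: "int p dvd S\<^sup>2 - int m" by simp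
  have "int p \<le> (int m)\<^sup>2 + int m + 1"
  proof (rule planar_bound_arith[OF _ AE ET _ _ _ Abound _ Sdvd])
    show "int m \<ge> 2" using m by simp
    show "0 \<le> T" unfolding T_def by (intro sum_nonneg) auto
    show "T \<le> A\<^sup>2" unfolding T_def A_def by (rule sum_squares_le_square_sum_abs) simp
    show "0 \<le> A" unfolding A_def by (intro sum_nonneg) auto
    show "\<bar>S\<bar> \<le> A" unfolding S_def A_def by (rule sum_abs)
    show "S\<^sup>2 \<noteq> int m" using m is_square_int_imp by blast
  qed
  then have "int p \<le> int (m\<^sup>2 + m + 1)" by simp
  then show ?thesis by (simp only: of_nat_le_iff)
qed

section \<open>Orbits of multiplication by t\<close>

text \<open>For \<open>i < j < f\<close> the factor \<open>t^(j - i) - 1\<close> is prime to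
  \<open>p\<close>, so a coincidence would make \<open>p^r\<close> divide \<open>x\<close>. The
  exponent \<open>r\<close> is \<open>b - 1\<close> for orbits of fibres and \<open>b\<close> for
  orbits inside fibre 0.\<close>

lemma inj_on_orbit:
  assumes pt: "\<not> p dvd t" and ord: "\<And>j. 0 < j \<Longrightarrow> j < f \<Longrightarrow> \<not> [t ^ j = 1] (mod p)"
    and x: "\<not> p ^ r dvd x"
  shows "inj_on (\<lambda>j. t ^ j * x mod p ^ r) {..<f}"
proof -
  have "i = j" if "i \<le> j" "j < f" "[t ^ j * x = t ^ i * x] (mod p ^ r)" for i j
  proof (rule ccontr)
    assume "i \<noteq> j"
    then have ij: "0 < j - i" "j - i < f" using that by auto
    have t1: "t ^ (j - i) \<ge> 1" using pt by (cases "t = 0") auto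
    have "p ^ r dvd t ^ j * x - t ^ i * x"
    proof -
      have "t \<ge> 1" using pt by (cases t) auto
      then have "t ^ i * x \<le> t ^ j * x" using that by (intro mult_right_mono power_increasing) auto
      then show ?thesis using that(3) by (simp add: cong_altdef_nat)
    qed
    also have "t ^ j * x - t ^ i * x = t ^ i * (t ^ (j - i) - 1) * x"
      using that(1) by (simp add: diff_mult_distrib diff_mult_distrib2 flip: power_add)
    finally have "p ^ r dvd (t ^ i * (t ^ (j - i) - 1)) * x" .
    moreover have "coprime (p ^ r) (t ^ i * (t ^ (j - i) - 1))"
    proof -
      have "\<not> p dvd t ^ (j - i) - 1" using ord[OF ij] t1 by (simp add: cong_altdef_nat)
      moreover have "\<not> p dvd t ^ i" using pt prime_p prime_dvd_power by blast
      ultimately have "\<not> p dvd t ^ i * (t ^ (j - i) - 1)" using prime_p by (simp add: prime_dvd_mult_iff)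
      then have "coprime p (t ^ i * (t ^ (j - i) - 1))" using prime_p by (rule prime_imp_coprime[rotated])
      then show ?thesis by (rule coprime_power_left_iff[THEN iffD2, OF disjI1])
    qed
    ultimately show False using x by (simp add: coprime_dvd_mult_right_iff)
  qed
  then have "i = j" if "i < f" "j < f" "t ^ i * x mod p ^ r = t ^ j * x mod p ^ r" for i j
    using that by (metis cong_def nat_le_linear)
  then show ?thesis by (auto intro!: inj_onI)
qed

text \<open>Multiplying \<open>Y\<close> by \<zeta>^k with \<open>(t - 1) * k \<equiv> -i\<close>
  modulo \<open>n\<close> absorbs the factor \<zeta>^i. The sign then satisfies
  \<open>e^f = 1\<close>, and \<open>f\<close> is odd.\<close>

lemma semi_invariant_normalise:
  assumes Y: "ev \<zeta> Y * cnj (ev \<zeta> Y) = of_nat m" and m: "m > 0"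
    and t: "\<not> p dvd t" "\<not> [t = 1] (mod p)" "[t ^ f = 1] (mod n)" and f: "odd f"
    and inv: "ev (\<zeta> ^ t) Y = of_int e * \<zeta> ^ i * ev \<zeta> Y" "e = 1 \<or> e = -1"
  obtains Z where "ev \<zeta> Z * cnj (ev \<zeta> Z) = of_nat m" "ev (\<zeta> ^ t) Z = ev \<zeta> Z"
proof -
  have t1: "t \<ge> 1" using t(1) by (cases t) auto
  have "\<not> p dvd t - 1" using t(2) t1 by (simp add: cong_altdef_nat)
  then have "coprime (t - 1) n" by (simp add: coprime_n_iff)
  then obtain x where x: "[(t - 1) * x = 1] (mod n)" using cong_solve_coprime_nat by auto
  \<comment> \<open>\<open>x\<close> inverts \<open>t - 1\<close>, and \<open>n - 1\<close> stands
    for -1.\<close>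
  define k where "k = x * (i * (n - 1))"
  have "[(t - 1) * k = 1 * (i * (n - 1))] (mod n)"
    unfolding k_def mult.assoc[symmetric] using cong_scalar_right[OF x, of "i * (n - 1)"] by (simp add: mult.assoc)
  then have "[k + (t - 1) * k + i = k + 1 * (i * (n - 1)) + i] (mod n)"
    by (intro cong_add cong_refl)
  moreover have "k + (t - 1) * k + i = t * k + i" using t1 by (cases t) auto
  moreover have "k + 1 * (i * (n - 1)) + i = k + i * n" using n_pos by (cases n) auto
  ultimately have "[t * k + i = k + i * n] (mod n)" by (simp only:)
  moreover have "[k + i * n = k] (mod n)" by (simp add: cong_def)
  ultimately have "[t * k + i = k] (mod n)" by (rule cong_trans)
  then have zk: "\<zeta> ^ (t * k + i) = \<zeta> ^ k" by (rule zeta_power_cong)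
  define Z where "Z = monom 1 k * Y"
  have "ev (\<zeta> ^ t) Z = \<zeta> ^ (t * k) * (of_int e * \<zeta> ^ i * ev \<zeta> Y)"
    using inv(1) by (simp add: Z_def power_mult)
  also have "\<dots> = of_int e * (\<zeta> ^ (t * k + i) * ev \<zeta> Y)" by (simp add: power_add mult_ac)
  finally have Ze: "ev (\<zeta> ^ t) Z = of_int e * ev \<zeta> Z" unfolding zk by (simp add: Z_def)
  have "ev \<zeta> Z * cnj (ev \<zeta> Z) = (\<zeta> ^ k * cnj (\<zeta> ^ k)) * (ev \<zeta> Y * cnj (ev \<zeta> Y))"
    by (simp add: Z_def mult_ac)
  then have normZ: "ev \<zeta> Z * cnj (ev \<zeta> Z) = of_nat m" unfolding zeta_power_mult_cnj Y by simp
  have it: "ev (\<zeta> ^ (t ^ j)) Z = of_int e ^ j * ev \<zeta> Z" for j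
  proof (induction j)
    case (Suc j)
    have "ev (\<zeta> ^ 1) (pcompose Z (monom 1 t) - smult e Z) = 0" using Ze by simp
    then have "ev (\<zeta> ^ (t ^ j)) (pcompose Z (monom 1 t) - smult e Z) = 0"
      by (rule ev_conjugate_eq_0) (use p_ge_3 t(1) prime_p prime_dvd_power in auto)
    then have "ev (\<zeta> ^ (t ^ Suc j)) Z = of_int e * ev (\<zeta> ^ (t ^ j)) Z"
      by (simp add: mult.commute flip: power_mult)
    then show ?case using Suc by simp
  qed simp
  have "ev \<zeta> Z \<noteq> 0" using normZ m by auto
  moreover have "\<zeta> ^ (t ^ f) = \<zeta>" using zeta_power_cong[OF t(3)] by simp
  ultimately have "of_int e ^ f = (1 :: complex)" using it[of f] by simp
  then have "e = 1" using inv(2) f by auto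
  then show ?thesis using that[OF normZ] Ze by simp
qed

text \<open>Multiplication by \<open>t\<close> preserves spreads, and its orbits have length
  \<open>f\<close> away from 0. As \<open>f > m\<close>, all the spread sits on fibre 0, where
  \<open>c\<close> is constant on orbits; a value class and its complement both of size at least
  \<open>f\<close> give the bound.\<close>

lemma orbit_bound:
  assumes Y: "ev \<zeta> Z * cnj (ev \<zeta> Z) = of_nat m" and inv: "ev (\<zeta> ^ t) Z = ev \<zeta> Z"
    and m: "\<not> is_square m" and fm: "f > m"
    and pt: "\<not> p dvd t" and ord: "\<And>j. 0 < j \<Longrightarrow> j < f \<Longrightarrow> \<not> [t ^ j = 1] (mod p)"
  shows "int f * (int p - int f) \<le> (int p - 1) * int m"
proof -
  obtain c where c: "\<And>k. ev (\<zeta> ^ k) Z = F c k" using ev_eq_F by blast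
  have tr: "(\<Sum>w<N. spread c (fibre w)) = (int p - 1) * int m"
    using norm_conjugate[OF Y] by (intro trace_identity) (simp add: c)
  define \<pi> where "\<pi> i = t * i mod n" for i
  have cop: "coprime t n" using pt by (simp add: coprime_n_iff)
  have inj\<pi>: "inj_on \<pi> {..<n}"
  proof (rule inj_onI)
    fix i j assume ij: "i \<in> {..<n}" "j \<in> {..<n}" "\<pi> i = \<pi> j"
    then have "[t * i = t * j] (mod n)" by (simp add: \<pi>_def cong_def)
    then have "[i = j] (mod n)" using cop by (simp add: cong_mult_lcancel_nat)
    then show "i = j" using ij by (simp add: cong_def)
  qed
  have \<pi>n: "\<pi> ` {..<n} \<subseteq> {..<n}" using n_pos by (auto simp: \<pi>_def)
  then have bij\<pi>: "bij_betw \<pi> {..<n} {..<n}"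
    using inj\<pi> by (simp add: bij_betw_def endo_inj_surj)
  \<comment> \<open>\<open>Z\<close> is fixed, so \<open>c \<circ> \<pi>\<close> and
    \<open>c\<close> have the same transform at \<open>t\<close>; their difference is constant on
    each fibre.\<close>
  have diff: "c (\<pi> i) - c (\<pi> j) = c i - c j" if "w < N" "i \<in> fibre w" "j \<in> fibre w" for w i j
  proof -
    define d where "d i = c (\<pi> i) - c i" for i
    have "(\<Sum>i<n. of_int (c (\<pi> i)) * \<zeta> ^ (i * t)) = (\<Sum>i<n. of_int (c (\<pi> i)) * \<zeta> ^ (\<pi> i))"
      unfolding \<pi>_def zeta_power_mod by (simp add: mult.commute)
    also have "\<dots> = F c 1"
      unfolding F_def by (subst sum.reindex_bij_betw[OF bij\<pi>, of "\<lambda>i. of_int (c i) * \<zeta> ^ i"]) simp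
    also have "\<dots> = F c t" using inv c[of 1] c[of t] by simp
    finally have "F d t = 0"
      by (simp add: F_def d_def algebra_simps sum_subtractf)
    then have "d i = d j" using pt that by (rule F_eq_0_imp_const)
    then show ?thesis by (simp add: d_def)
  qed
  have \<pi>fib: "\<pi> i \<in> fibre (t * w mod N)" if "i \<in> fibre w" for i w
    using that n_pos by (auto simp: fibre_def \<pi>_def n_eq mod_mod_cancel mod_mult_right_eq)
  have sp1: "spread c (fibre (t * w mod N)) = spread c (fibre w)" if w: "w < N" for w
  proof (rule spread_reindex[where h = \<pi>])
    have "inj_on \<pi> (fibre w)" by (rule inj_on_subset[OF inj\<pi>]) (auto simp: fibre_def)
    moreover have "\<pi> ` fibre w = fibre (t * w mod N)"
    proof (rule card_subset_eq)
      show "\<pi> ` fibre w \<subseteq> fibre (t * w mod N)" using \<pi>fib by auto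
      show "card (\<pi> ` fibre w) = card (fibre (t * w mod N))"
        using calculation w N_pos by (simp add: card_image card_fibre)
    qed simp
    ultimately show "bij_betw \<pi> (fibre w) (fibre (t * w mod N))" by (simp add: bij_betw_def)
  qed (use diff w in auto)
  have spj: "spread c (fibre (t ^ j * w mod N)) = spread c (fibre w)" if w: "w < N" for w j
  proof (induction j)
    case 0
    then show ?case using w by simp
  next
    case (Suc j)
    have "t ^ Suc j * w mod N = t * (t ^ j * w mod N) mod N" by (simp add: mod_mult_right_eq mult.assoc)
    then show ?case using sp1[of "t ^ j * w mod N"] Suc N_pos by simp
  qed
  \<comment> \<open>Otherwise the \<open>f\<close> fibres in the orbit of \<open>w\<close> would
    each carry spread at least \<open>p - 1\<close>, in total more than
    \<open>(p - 1) * m\<close>.\<close>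
  have zero: "spread c (fibre w) = 0" if w: "w < N" "w \<noteq> 0" for w
  proof (rule ccontr)
    assume nz: "spread c (fibre w) \<noteq> 0"
    have inj: "inj_on (\<lambda>j. t ^ j * w mod N) {..<f}"
      unfolding N_def by (rule inj_on_orbit[OF pt ord]) (use w in \<open>auto simp: N_def dest: dvd_imp_le\<close>)
    have "int f * (int p - 1) = (\<Sum>j<f. int p - 1)" by simp
    also have "\<dots> \<le> (\<Sum>j<f. spread c (fibre (t ^ j * w mod N)))"
      using spread_fibre_ge[OF w(1) nz] by (intro sum_mono) (simp add: spj[OF w(1)])
    also have "\<dots> = (\<Sum>w'\<in>(\<lambda>j. t ^ j * w mod N) ` {..<f}. spread c (fibre w'))"
      by (simp add: sum.reindex[OF inj])
    also have "\<dots> \<le> (\<Sum>w<N. spread c (fibre w))"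
      using N_pos by (intro sum_mono2) (auto intro: spread_nonneg)
    also have "\<dots> = int m * (int p - 1)" unfolding tr by (rule mult.commute)
    finally have "int f \<le> int m" using p_ge_3 by simp
    then show False using fm by simp
  qed
  have "(\<Sum>w<N. spread c (fibre w)) = spread c (fibre 0) + (\<Sum>w\<in>{..<N} - {0}. spread c (fibre w))"
    using N_pos by (simp add: sum.remove)
  also have "(\<Sum>w\<in>{..<N} - {0}. spread c (fibre w)) = 0" using zero by (intro sum.neutral) auto
  finally have tot: "spread c (fibre 0) = (int p - 1) * int m" using tr by simp
  have z0: "0 \<in> fibre 0" using n_pos by (simp add: fibre_def)
  have c\<pi>: "c (\<pi> i) = c i" "\<pi> i \<in> fibre 0" if "i \<in> fibre 0" for i
    using diff[OF N_pos that z0] \<pi>fib[OF that] by (auto simp: \<pi>_def)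
  \<comment> \<open>On fibre 0 the constant difference is zero, since \<open>\<pi>\<close> fixes
    0.\<close>
  have orb: "t ^ j * i mod n \<in> fibre 0 \<and> c (t ^ j * i mod n) = c i" if i: "i \<in> fibre 0" for i j
  proof (induction j)
    case 0
    then show ?case using i by (simp add: fibre_def)
  next
    case (Suc j)
    have "t ^ Suc j * i mod n = \<pi> (t ^ j * i mod n)" by (simp add: \<pi>_def mod_mult_right_eq mult.assoc)
    then show ?case using c\<pi>[of "t ^ j * i mod n"] Suc by simp
  qed
  have orbit_card: "f \<le> card B" if "i \<in> fibre 0 - {0}" "finite B" "\<And>j. t ^ j * i mod n \<in> B" for i B
  proof -
    have "inj_on (\<lambda>j. t ^ j * i mod n) {..<f}"
      unfolding n_def by (rule inj_on_orbit[OF pt ord])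
        (use that(1) in \<open>auto simp: fibre_def n_def dest: dvd_imp_le\<close>)
    then have "f = card ((\<lambda>j. t ^ j * i mod n) ` {..<f})" by (simp add: card_image)
    also have "\<dots> \<le> card B" using that by (intro card_mono) auto
    finally show ?thesis .
  qed
  show ?thesis
  proof (cases "\<exists>i\<in>fibre 0 - {0}. \<exists>j\<in>fibre 0 - {0}. c i \<noteq> c j")
    case True
    then obtain i j where ij: "i \<in> fibre 0 - {0}" "j \<in> fibre 0 - {0}" "c i \<noteq> c j" by blast
    define S where "S = {x \<in> fibre 0. c x = c i}"
    have "f \<le> card S" using ij orb by (intro orbit_card[of i]) (auto simp: S_def)
    moreover have "f \<le> card (fibre 0 - S)" using ij orb by (intro orbit_card[of j]) (auto simp: S_def)
    moreover have "card (fibre 0 - S) = p - card S"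
      using N_pos by (subst card_Diff_subset) (auto simp: S_def card_fibre)
    moreover have "card S \<le> p"
      using card_mono[of "fibre 0" S] N_pos by (auto simp: S_def card_fibre)
    ultimately have "int f * (int p - int f) \<le> int (card S) * (int p - int (card S))"
      by (intro mult_diff_mono) auto
    also have "\<dots> \<le> spread c (fibre 0)"
      using spread_ge_value_class[of "fibre 0" c "c i"] N_pos by (simp add: S_def card_fibre)
    finally show ?thesis unfolding tot .
  next
    \<comment> \<open>If \<open>c\<close> is constant on fibre 0 except at 0, the spread is
      \<open>p - 1\<close> times a square, which makes \<open>m\<close> a square.\<close>
    case False
    have "card (fibre 0 - {0}) > 0" using z0 N_pos p_ge_3 by (simp add: card_fibre)
    then obtain i where i: "i \<in> fibre 0 - {0}" by (metis card_gt_0_iff ex_in_conv)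
    have "\<And>j. j \<in> fibre 0 - {0} \<Longrightarrow> c j = c i" using False i by blast
    from spread_one_off[OF finite_fibre z0 this]
    have "(int p - 1) * (c 0 - c i)\<^sup>2 = (int p - 1) * int m" using tot N_pos by (simp add: card_fibre)
    then have "(c 0 - c i)\<^sup>2 = int m" using p_ge_3 by simp
    then show ?thesis using m is_square_int_imp by blast
  qed
qed

section \<open>Powers modulo the level\<close>

lemma power_N_cong:
  assumes "int p dvd x - y"
  shows "int n dvd x ^ N - y ^ N"
  using power_prime_power_cong[of p x y "b - 1"] assms b_pos by (simp add: n_def N_def)

lemma ord_dvd_p_minus_1: "\<not> p dvd q \<Longrightarrow> ord p q dvd p - 1"
  using order_divides_totient[of p q] prime_imp_coprime[of p q] prime_p by (simp add: totient_prime)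

text \<open>Half the order gives a power of \<open>q\<close> that is -1 modulo \<open>p\<close>; its
  \<open>N\<close>-th power is -1 modulo \<open>n\<close>, as \<open>N\<close> is odd.\<close>

lemma minus_one_power:
  assumes q: "\<not> p dvd q" and even: "even (ord p q)"
  obtains j where "[q ^ j = n - 1] (mod n)"
proof -
  have "coprime p q" using prime_imp_coprime[of p q] prime_p q by simp
  then have pos: "ord p q > 0" by simp
  obtain d where d: "ord p q = 2 * d" using even by blast
  define y where "y = q ^ d"
  have "[y\<^sup>2 = 1] (mod p)" using ord[of q p] by (simp add: y_def d mult.commute flip: power_mult)
  moreover have y1: "\<not> [y = 1] (mod p)" unfolding y_def by (rule ord_minimal) (use pos d in auto)
  ultimately have "int p dvd (int y)\<^sup>2 - 1" "\<not> int p dvd int y - 1"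
    by (simp_all add: cong_iff_dvd_diff flip: cong_int_iff)
  moreover have "(int y)\<^sup>2 - 1 = (int y - 1) * (int y - (-1))" by (simp add: power2_eq_square algebra_simps)
  ultimately have "int p dvd int y - (-1)" using prime_p by (simp add: prime_dvd_mult_iff)
  then have "int n dvd int y ^ N - (-1) ^ N" by (rule power_N_cong)
  moreover have "odd N" using odd_p by (simp add: N_def)
  ultimately have "int n dvd int (q ^ (d * N)) + 1" by (simp add: y_def power_mult)
  then have "int n dvd int (q ^ (d * N)) + 1 - int n" by simp
  then have "int n dvd int (q ^ (d * N)) - int (n - 1)" using n_pos by (simp add: of_nat_diff algebra_simps)
  then have "[q ^ (d * N) = n - 1] (mod n)" by (simp only: cong_iff_dvd_diff flip: cong_int_iff)
  then show ?thesis by (rule that)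
qed

text \<open>In the cyclic unit group modulo \<open>n\<close>, with generator \<open>r\<close>, the
  element \<open>t = r^h\<close> with \<open>h = totient n / f\<close> generates the subgroup of
  order \<open>f\<close>, which lies in the group generated by each \<open>q\<close>. Its order
  modulo \<open>p\<close> is still \<open>f\<close> because \<open>f\<close> is prime to
  \<open>N\<close>.\<close>

lemma common_power_of_order:
  assumes f: "f > 0" and Q: "Q \<noteq> {}" "\<And>q. q \<in> Q \<Longrightarrow> \<not> p dvd q \<and> f dvd ord p q"
  obtains t where "\<not> p dvd t" "[t ^ f = 1] (mod n)"
    "\<And>j. 0 < j \<Longrightarrow> j < f \<Longrightarrow> \<not> [t ^ j = 1] (mod p)" "\<And>q. q \<in> Q \<Longrightarrow> \<exists>j. [t = q ^ j] (mod n)"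
proof -
  obtain r where "residue_primroot n r"
    using residue_primroot_odd_prime_power_exists[OF prime_p odd_p] b_pos unfolding n_def by metis
  then have r: "coprime n r" "ord n r = totient n" and rp: "residue_primroot n r"
    by (auto simp: residue_primroot_def)
  have tot: "totient n = N * (p - 1)" using prime_p b_pos by (simp add: n_def N_def totient_prime_power)
  have fp: "f dvd p - 1" using Q ord_dvd_p_minus_1 dvd_trans by blast
  then obtain h0 where "p - 1 = f * h0" by blast
  then obtain h where h: "totient n = f * h" using tot by (metis mult.left_commute)
  have h0: "h > 0" using h tot N_pos p_ge_3 by (intro gr0I) auto
  define t where "t = r ^ h"
  have pr: "\<not> p dvd r" using r(1) by (simp add: coprime_n_iff coprime_commute)
  show ?thesis
  proof (rule that)
    show "\<not> p dvd t" unfolding t_def using pr prime_p prime_dvd_power by blast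
    show "[t ^ f = 1] (mod n)" unfolding t_def power_mult[symmetric] ord_divides r(2) h by (simp add: mult.commute)
    show "\<not> [t ^ j = 1] (mod p)" if j: "0 < j" "j < f" for j
    proof
      assume "[t ^ j = 1] (mod p)"
      then have "int p dvd int (t ^ j) - 1" by (simp add: cong_iff_dvd_diff flip: cong_int_iff)
      then have "int n dvd int (t ^ j) ^ N - 1 ^ N" by (rule power_N_cong)
      then have "[t ^ (j * N) = 1] (mod n)" by (simp add: cong_iff_dvd_diff power_mult flip: cong_int_iff)
      then have "f * h dvd h * (j * N)" unfolding t_def power_mult[symmetric] ord_divides r(2) h .
      then have "f dvd j * N" using h0 by (simp add: mult.commute)
      moreover have "coprime f N"
      proof -
        have "f < p" using dvd_imp_le[OF fp] p_ge_3 by simp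
        then have "\<not> p dvd f" using f by (simp add: nat_dvd_not_less)
        then have "coprime p f" using prime_p by (rule prime_imp_coprime[rotated])
        then show ?thesis by (simp add: N_def coprime_commute)
      qed
      ultimately have "f dvd j" by (simp add: coprime_dvd_mult_left_iff)
      then show False using j by (auto dest: dvd_imp_le)
    qed
    show "\<exists>j. [t = q ^ j] (mod n)" if q: "q \<in> Q" for q
    proof -
      have pq: "\<not> p dvd q" and fq: "f dvd ord p q" using Q(2)[OF q] by auto
      have "coprime q n" using pq by (simp add: coprime_n_iff)
      then have "q mod n \<in> totatives n"
        using N_less_n N_pos by (auto simp: totatives_def coprime_commute intro!: gr0I)
      then obtain e where e: "q mod n = r ^ e mod n"
        using residue_primroot_is_generator[OF _ rp] N_less_n N_pos by (force simp: bij_betw_def)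
      then have qe: "[q = r ^ e] (mod n)" by (simp add: cong_def)
      have "[q ^ ord n q = 1] (mod p)" using ord[of q n] n_eq by (metis cong_modulus_mult_nat)
      then have "ord p q dvd ord n q" by (simp only: ord_divides)
      then have "f dvd ord n (r ^ e)" using fq ord_cong[OF qe] dvd_trans by metis
      then obtain u where u: "ord n (r ^ e) = f * u" by blast
      \<comment> \<open>The order of \<open>r^e\<close> is
        \<open>totient n / gcd e (totient n)\<close>, so \<open>gcd e (totient n)\<close> divides
        \<open>h\<close> and \<open>r^h\<close> is a power of \<open>r^e\<close>.\<close>
      have "f * h = f * (u * gcd e (totient n))"
        using ord_power_aux[of n r e] by (simp add: r(2) u h[symmetric] mult.assoc)
      then have hu: "h = gcd e (totient n) * u" using f by simp
      obtain x where x: "[e * x = gcd e (totient n)] (mod totient n)" using cong_solve_nat by blast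
      have "[e * x * u = h] (mod totient n)" unfolding hu using x by (rule cong_scalar_right)
      then have "[r ^ (e * (x * u)) = r ^ h] (mod n)"
        by (simp add: order_divides_expdiff[OF r(1)] r(2) mult.assoc)
      then have "[(r ^ e) ^ (x * u) = t] (mod n)" by (simp add: t_def power_mult)
      moreover have "[q ^ (x * u) = (r ^ e) ^ (x * u)] (mod n)" using qe by (rule cong_pow)
      ultimately have "[t = q ^ (x * u)] (mod n)" using cong_sym cong_trans by blast
      then show ?thesis by blast
    qed
  qed
qed

text \<open>As \<open>n\<close> is odd, a \<open>2 * n\<close>-th root of unity is an
  \<open>n\<close>-th root of unity up to sign, so both kinds of matrix have entries in
  Z[\<zeta>].\<close>

lemma ev_root_of_unity:
  assumes "z ^ n = 1 \<or> z ^ (2 * n) = 1"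
  shows "\<exists>P. z = ev \<zeta> P"
proof -
  have root: "\<exists>k. w = \<zeta> ^ k" if "w ^ n = 1" for w
  proof -
    have "w \<in> (\<lambda>k. cis (2 * pi * real k / real n)) ` {..<n}"
      using bij_betw_roots_unity[OF n_pos] that by (simp add: bij_betw_def)
    then obtain k where "w = cis (2 * pi * real k / real n)" by blast
    then have "w = \<zeta> ^ k" by (simp add: \<zeta>_def DeMoivre mult.commute)
    then show ?thesis by blast
  qed
  have "z ^ n = 1 \<or> (- z) ^ n = 1"
  proof (cases "z ^ n = 1")
    case False
    then have "(z ^ n)\<^sup>2 = 1" using assms by (simp add: mult.commute flip: power_mult)
    then have "z ^ n = -1" using False by (simp add: power2_eq_1_iff)
    then show ?thesis using odd_n by simp
  qed simp
  then show ?thesis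
  proof
    assume "z ^ n = 1"
    then obtain k where "z = \<zeta> ^ k" using root by blast
    then have "z = ev \<zeta> (monom 1 k)" by simp
    then show ?thesis by blast
  next
    assume "(- z) ^ n = 1"
    then obtain k where "- z = \<zeta> ^ k" using root by blast
    then have "z = - (\<zeta> ^ k)" by (metis minus_minus)
    then have "z = ev \<zeta> (monom (-1) k)" by simp
    then show ?thesis by blast
  qed
qed

lemma ev_sum_closed:
  assumes "\<And>x. x \<in> A \<Longrightarrow> \<exists>P. u x = ev \<zeta> P"
  shows "\<exists>P. (\<Sum>x\<in>A. u x) = ev \<zeta> P"
proof -
  obtain P where "\<And>x. x \<in> A \<Longrightarrow> u x = ev \<zeta> (P x)" using assms by metis
  then have "(\<Sum>x\<in>A. u x) = ev \<zeta> (\<Sum>x\<in>A. P x)" by simp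
  then show ?thesis by blast
qed

end

section \<open>Group-invariant Butson Hadamard matrices\<close>

text \<open>By invariance every column sum equals the sum \<open>X\<close> of row
  \<open>\<one>\<close>. Summing the inner products of row \<open>\<one>\<close> with all rows gives
  \<open>X * cnj X\<close>, and only the product with itself is nonzero.\<close>

lemma BH_row_sum_norm:
  fixes G (structure)
  assumes "group G" "finite (carrier G)" "is_BH G h H"
  shows "(\<Sum>l\<in>carrier G. H \<one> l) * cnj (\<Sum>l\<in>carrier G. H \<one> l) = of_nat (order G)"
proof -
  interpret group G by fact
  have inv: "H (x \<otimes> l) (y \<otimes> l) = H x y" if "x \<in> carrier G" "y \<in> carrier G" "l \<in> carrier G" for x y l
    using assms(3) that by (auto simp: is_BH_def)
  have orth: "(\<Sum>l\<in>carrier G. H x l * cnj (H y l)) = (if x = y then of_nat (order G) else 0)"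
    if "x \<in> carrier G" "y \<in> carrier G" for x y
    using assms(3) that by (auto simp: is_BH_def)
  define X where "X = (\<Sum>l\<in>carrier G. H \<one> l)"
  have col: "(\<Sum>k\<in>carrier G. H k l) = X" if l: "l \<in> carrier G" for l
  proof -
    \<comment> \<open>Invariance gives \<open>H k l = H \<one> (l \<otimes> inv k)\<close>, so
      column \<open>l\<close> is a rearrangement of row \<open>\<one>\<close>.\<close>
    have "bij_betw (\<lambda>k. l \<otimes> inv k) (carrier G) (carrier G)"
    proof (rule bij_betwI[where g = "\<lambda>k. inv k \<otimes> l"])
      show "inv (l \<otimes> inv k) \<otimes> l = k" if "k \<in> carrier G" for k
        using l that by (simp add: inv_mult_group m_assoc)
      show "l \<otimes> inv (inv k \<otimes> l) = k" if "k \<in> carrier G" for k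
        using l that by (simp add: inv_mult_group) (simp flip: m_assoc)
    qed (use l in auto)
    then have "X = (\<Sum>k\<in>carrier G. H \<one> (l \<otimes> inv k))"
      unfolding X_def by (rule sum.reindex_bij_betw[symmetric])
    also have "\<dots> = (\<Sum>k\<in>carrier G. H k l)"
    proof (intro sum.cong refl)
      fix k assume k: "k \<in> carrier G"
      have "H (\<one> \<otimes> k) (l \<otimes> inv k \<otimes> k) = H \<one> (l \<otimes> inv k)" using k l by (intro inv) auto
      then show "H \<one> (l \<otimes> inv k) = H k l" using k l by (simp add: m_assoc)
    qed
    finally show ?thesis by simp
  qed
  have "of_nat (order G) = (\<Sum>k\<in>carrier G. if \<one> = k then of_nat (order G) else 0)"
    using assms(2) by simp
  also have "\<dots> = (\<Sum>k\<in>carrier G. \<Sum>l\<in>carrier G. H \<one> l * cnj (H k l))"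
    by (intro sum.cong) (auto simp: orth)
  also have "\<dots> = (\<Sum>l\<in>carrier G. \<Sum>k\<in>carrier G. H \<one> l * cnj (H k l))" by (rule sum.swap)
  also have "\<dots> = (\<Sum>l\<in>carrier G. H \<one> l * cnj (\<Sum>k\<in>carrier G. H k l))"
    by (simp add: sum_distrib_left)
  also have "\<dots> = X * cnj X" using col by (simp add: X_def sum_distrib_right)
  finally show ?thesis by (simp add: X_def)
qed

theorem theorem3p11:
  fixes G :: "('a, 'b) monoid_scheme" and b p c m f :: nat
  assumes "b > 0"
    and "prime p" and "odd p"
    and "comm_group G" and "finite (carrier G)"
    and "order G = p ^ c * m" and "\<not> p dvd m"
    and "\<not> is_square m"
    and "f = Gcd (ord p ` prime_factors m)"
    and "(\<exists>H. is_BH G (p ^ b) H) \<or> (\<exists>H. is_BH G (2 * p ^ b) H)"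
  shows "odd f
    \<and> (f \<le> m \<or> real p \<le> ((real f)\<^sup>2 - real m) / (real f - real m))
    \<and> p \<le> m\<^sup>2 + m + 1"
proof -
  interpret odd_prime_power p b using assms(1-3) by unfold_locales
  have grp: "group G" using assms(4) by (rule comm_group.axioms(2))
  obtain h H where H: "is_BH G h H" "h = n \<or> h = 2 * n"
    using assms(10) unfolding n_def by blast
  have one: "\<one>\<^bsub>G\<^esub> \<in> carrier G" using grp by (simp add: group.is_monoid monoid.one_closed)
  have "\<exists>P. (\<Sum>l\<in>carrier G. H \<one>\<^bsub>G\<^esub> l) = ev \<zeta> P"
  proof (rule ev_sum_closed, rule ev_root_of_unity)
    fix l assume "l \<in> carrier G"
    then have "H \<one>\<^bsub>G\<^esub> l ^ h = 1" using H(1) one unfolding is_BH_def by blast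
    then show "H \<one>\<^bsub>G\<^esub> l ^ n = 1 \<or> H \<one>\<^bsub>G\<^esub> l ^ (2 * n) = 1" using H(2) by blast
  qed
  then obtain P where "(\<Sum>l\<in>carrier G. H \<one>\<^bsub>G\<^esub> l) = ev \<zeta> P" by blast
  then have "ev \<zeta> P * cnj (ev \<zeta> P) = of_nat (p ^ c * m)"
    using BH_row_sum_norm[OF grp assms(5) H(1)] assms(6) by simp
  then obtain Y where Y: "ev \<zeta> Y * cnj (ev \<zeta> Y) = of_nat m" using norm_divide_p_power by blast
  have "m \<noteq> 0" using assms(7) by (metis dvd_0_right)
  moreover have "m \<noteq> 1" using assms(8) is_square_int_imp[of 1 m] by auto
  ultimately have m2: "m \<ge> 2" by simp
  have pf: "\<not> p dvd q" "prime q" "q \<noteq> p" "f dvd ord p q" if "q \<in> prime_factors m" for q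
  proof -
    show "prime q" using that by auto
    show "q \<noteq> p" using that assms(7) by auto
    then show "\<not> p dvd q" using \<open>prime q\<close> prime_not_p by blast
    show "f dvd ord p q" unfolding assms(9) using that by (intro Gcd_dvd) auto
  qed
  have ne: "prime_factors m \<noteq> {}" using m2 by (simp add: prime_factorization_empty_iff)
  have "odd f"
  proof
    assume "even f"
    \<comment> \<open>For even \<open>f\<close> every prime divisor of \<open>m\<close> has even
      order modulo \<open>p\<close>, so -1 is one of its powers modulo \<open>n\<close>.\<close>
    have "even (multiplicity q m)" if "prime q" for q
    proof (cases "q dvd m")
      case True
      then have q: "q \<in> prime_factors m" using that m2 by (auto simp: in_prime_factors_iff)
      have "even (ord p q)" using \<open>even f\<close> pf(4)[OF q] by (rule dvd_trans)
      then obtain j where "[q ^ j = n - 1] (mod n)" using minus_one_power pf(1)[OF q] by blast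
      then show ?thesis using self_conjugate_even_multiplicity[OF Y _ pf(2,3)[OF q]] m2 by simp
    next
      case False
      then show ?thesis by (simp add: not_dvd_imp_multiplicity_0)
    qed
    then have "is_square m" by (simp add: is_nth_power_conv_multiplicity_nat)
    then show False using assms(8) by simp
  qed
  moreover have "f \<le> m \<or> real p \<le> ((real f)\<^sup>2 - real m) / (real f - real m)"
  proof (cases "f \<le> m")
    case False
    then have fm: "f > m" by simp
    have "f > 0" using fm by simp
    then obtain t where t: "\<not> p dvd t" "[t ^ f = 1] (mod n)"
      "\<And>j. 0 < j \<Longrightarrow> j < f \<Longrightarrow> \<not> [t ^ j = 1] (mod p)"
      "\<And>q. q \<in> prime_factors m \<Longrightarrow> \<exists>j. [t = q ^ j] (mod n)"
      using common_power_of_order[OF _ ne] pf by blast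
    \<comment> \<open>\<open>f > m \<ge> 2\<close> allows the exponent 1.\<close>
    have t1: "\<not> [t = 1] (mod p)" using t(3)[of 1] fm m2 by simp
    obtain e :: int and i where ei: "e = 1 \<or> e = -1" "ev (\<zeta> ^ t) Y = of_int e * \<zeta> ^ i * ev \<zeta> Y"
      using decomposition_semi_invariant[OF Y _ assms(7) t(1,4)] m2 by auto
    obtain Z where Z: "ev \<zeta> Z * cnj (ev \<zeta> Z) = of_nat m" "ev (\<zeta> ^ t) Z = ev \<zeta> Z"
      using semi_invariant_normalise[OF Y _ t(1) t1 t(2) \<open>odd f\<close> ei(2,1)] m2 by auto
    have "int f * (int p - int f) \<le> (int p - 1) * int m"
      by (rule orbit_bound[OF Z assms(8) fm t(1,3)])
    then have "real_of_int (int f * (int p - int f)) \<le> real_of_int ((int p - 1) * int m)"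
      by (simp only: of_int_le_iff)
    then have "real f * (real p - real f) \<le> (real p - 1) * real m" by simp
    then have "real p * (real f - real m) \<le> (real f)\<^sup>2 - real m"
      by (simp add: power2_eq_square algebra_simps)
    then show ?thesis using fm by (simp add: pos_le_divide_eq)
  qed simp
  moreover have "p \<le> m\<^sup>2 + m + 1" using planar_bound[OF Y m2 assms(8)] .
  ultimately show ?thesis by blast
qed

end
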